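(* Suppose that $f:\mathbb{R}^d\to\mathbb{R}$ is convex and twice continuously differentiable with a minimizer $x^*$, that the symmetric Hessian approximation satisfies $\|H(x)-\nabla^2 f(x)\|\le\delta$ for all $x$, and that $f$ satisfies either the global or the local generalized Hessian smoothness condition (with constants $M_0,M_1\ge0$, and radius $\rho>0$ in the local case). Let $D=\max\{\|x-x_0\|: f(x)\le f(x_0)\}<\infty$, $$B=\max\{1,2D/\rho,6\sqrt{M_1}D\},\qquad \varepsilon_{\rm tr}=\max\{M_0D^3/B^2,\ \delta D^2/B\},$$ $$\ell_0=\max\Big\{1,\ \frac{2D\|\nabla f(x_0)\|}{\varepsilon_{\rm tr}},\ \frac{\eta_0D^2}{\sqrt6\,B\,\varepsilon_{\rm tr}}\Big\}.$$ There is a universal constant $C>0$ such that for every $\varepsilon>0$ the adaptive regularized Newton method, started from $x_0$ with any $\eta_0>0$, generates an iterate $x_N$ satisfying $f(x_N)-f^*\le\varepsilon$ for some $$N\le C\left(1+\log\ell_0+B\log_+\frac{f(x_0)-f^*}{\max\{\varepsilon,\varepsilon_{\rm tr}\}}+\sqrt{\frac{M_0D^3}{\varepsilon}}+\frac{\delta D^2}{\varepsilon}\right).$$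
   Context: $\|\cdot\|$ is the Euclidean norm for vectors and the induced operator norm for matrices; $f^*=f(x^* )$; $\log_+t=\max\{0,\log t\}$ (equal to $0$ at $t=0$). Conventions: $a/(+\infty)=0$ for finite $a\ge0$ and $a/0=+\infty$ for $a>0$. If $D=0$ then $x_0$ is a minimizer and the claim is trivial with $N=0$. Put $L(x)=M_0+M_1\|\nabla f(x)\|$. Global generalized Hessian smoothness: $\|\nabla^2f(y)-\nabla^2f(x)\|\le L(x)\|y-x\|$ for all $x,y\in\mathbb{R}^d$; in this case set $\rho=+\infty$. Local generalized Hessian smoothness with radius $\rho>0$: the same inequality for all $x,y$ with $\|y-x\|\le\rho$. Procedure $\mathrm{MSBacktrack}(x,\tau)$ (for $x\in\mathbb{R}^d$, $\tau>0$): repeat the following trial. If $H(x)+\tau I\succ0$, solve $(H(x)+\tau I)s=-\nabla f(x)$; if moreover $\|\nabla f(x+s)+\tau s\|\le\frac{\tau}{2}\|s\|$, return the pair $(x+s,\tau)$. Otherwise (trial rejected) replace $\tau$ by $2\tau$. Adaptive regularized Newton method. Input $x_0\in\mathbb{R}^d$, $\eta_0>0$. For $k\ge0$: $(x_{k+1},\tau_k)=\mathrm{MSBacktrack}(x_k,\eta_k)$ and $\eta_{k+1}=\frac{\tau_k}{2}\min\big\{1,\frac{\|\nabla f(x_{k+1})\|}{\|\nabla f(x_k)\|}\big\}$. If $\nabla f(x_k)=0$ the method stops and returns the minimizer $x_k$. *)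

theory Defs
  imports "HOL-Analysis.Analysis"
begin

text \<open>
  The constant in the theorem must not depend on the dimension \<open>d\<close>, so \<open>d\<close> has to be quantified
  inside the formula and cannot be a type parameter.  All spaces \<open>\<real>\<^sup>d\<close> therefore live in one type, the
  finitely supported real sequences with the Euclidean inner product; \<open>Rn d\<close> is the subspace of
  vectors whose coordinates with index \<open>\<ge> d\<close> vanish.
\<close>

typedef fin_seq = "{x :: nat \<Rightarrow> real. finite {i. x i \<noteq> 0}}"
  morphisms coord Abs_fin_seq
  by (rule exI[of _ "\<lambda>_. 0"]) simp

setup_lifting type_definition_fin_seq

lemma fin_seq_eqI: "(\<And>i. coord x i = coord y i) \<Longrightarrow> x = y"
  by (simp add: coord_inject[symmetric] fun_eq_iff)

lemma finite_support: "finite {i. coord x i \<noteq> 0}"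
  using coord[of x] by simp

instantiation fin_seq :: real_inner
begin

lift_definition zero_fin_seq :: fin_seq is "\<lambda>_. 0" by simp

lift_definition plus_fin_seq :: "fin_seq \<Rightarrow> fin_seq \<Rightarrow> fin_seq" is "\<lambda>x y i. x i + y i"
  by (erule (1) rev_finite_subset[OF finite_UnI]) auto

lift_definition uminus_fin_seq :: "fin_seq \<Rightarrow> fin_seq" is "\<lambda>x i. - x i" by simp

lift_definition minus_fin_seq :: "fin_seq \<Rightarrow> fin_seq \<Rightarrow> fin_seq" is "\<lambda>x y i. x i - y i"
  by (erule (1) rev_finite_subset[OF finite_UnI]) auto

lift_definition scaleR_fin_seq :: "real \<Rightarrow> fin_seq \<Rightarrow> fin_seq" is "\<lambda>r x i. r * x i"
  by (erule rev_finite_subset) auto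

definition inner_fin_seq :: "fin_seq \<Rightarrow> fin_seq \<Rightarrow> real" where
  "inner_fin_seq x y = (\<Sum>i | coord x i \<noteq> 0. coord x i * coord y i)"

definition norm_fin_seq :: "fin_seq \<Rightarrow> real" where
  "norm_fin_seq x = sqrt (inner x x)"

definition sgn_fin_seq :: "fin_seq \<Rightarrow> fin_seq" where
  "sgn_fin_seq x = inverse (norm x) *\<^sub>R x"

definition dist_fin_seq :: "fin_seq \<Rightarrow> fin_seq \<Rightarrow> real" where
  "dist_fin_seq x y = norm (x - y)"

definition uniformity_fin_seq :: "(fin_seq \<times> fin_seq) filter" where
  [code del]: "uniformity_fin_seq = (INF e\<in>{0<..}. principal {(x, y). dist x y < e})"

definition open_fin_seq :: "fin_seq set \<Rightarrow> bool" where
  [code del]: "open_fin_seq U \<longleftrightarrow> (\<forall>x\<in>U. \<forall>\<^sub>F (x', y) in uniformity. x' = x \<longrightarrow> y \<in> U)"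

lemma inner_fin_seq_superset:
  assumes "finite I" "{i. coord x i \<noteq> 0} \<subseteq> I"
  shows "inner x y = (\<Sum>i\<in>I. coord x i * coord y i)"
  unfolding inner_fin_seq_def by (rule sum.mono_neutral_left) (use assms in auto)

instance
proof
  fix x y z :: fin_seq and a b r :: real
  show "x + y + z = x + (y + z)" "x + y = y + x" "0 + x = x" "- x + x = 0" "x - y = x + - y"
    by (transfer; simp add: algebra_simps fun_eq_iff)+
  show "a *\<^sub>R (x + y) = a *\<^sub>R x + a *\<^sub>R y" "(a + b) *\<^sub>R x = a *\<^sub>R x + b *\<^sub>R x"
    "a *\<^sub>R b *\<^sub>R x = (a * b) *\<^sub>R x" "1 *\<^sub>R x = x"
    by (transfer; simp add: algebra_simps fun_eq_iff)+
  show "sgn x = inverse (norm x) *\<^sub>R x" by (rule sgn_fin_seq_def)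
  show "dist x y = norm (x - y)" by (rule dist_fin_seq_def)
  show "uniformity = (INF e\<in>{0<..}. principal {(x, y). dist (x::fin_seq) y < e})"
    by (rule uniformity_fin_seq_def)
  show "open U = (\<forall>x\<in>U. \<forall>\<^sub>F (x', y) in uniformity. x' = x \<longrightarrow> y \<in> U)" for U :: "fin_seq set"
    by (rule open_fin_seq_def)
  show "norm x = sqrt (inner x x)" by (rule norm_fin_seq_def)
  let ?I = "{i. coord x i \<noteq> 0} \<union> {i. coord y i \<noteq> 0} \<union> {i. coord z i \<noteq> 0}"
  have I: "finite ?I" by (simp add: finite_support)
  have sub: "{i. coord (x + y) i \<noteq> 0} \<subseteq> ?I" "{i. coord (r *\<^sub>R x) i \<noteq> 0} \<subseteq> ?I"
    by (auto simp: plus_fin_seq.rep_eq scaleR_fin_seq.rep_eq)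
  have xI: "inner x w = (\<Sum>i\<in>?I. coord x i * coord w i)"
    and yI: "inner y w = (\<Sum>i\<in>?I. coord y i * coord w i)" for w
    by (rule inner_fin_seq_superset[OF I]; auto)+
  show "inner x y = inner y x"
    by (simp add: xI yI mult.commute)
  show "inner (x + y) z = inner x z + inner y z"
    unfolding inner_fin_seq_superset[OF I sub(1)] xI yI
    by (simp add: plus_fin_seq.rep_eq algebra_simps sum.distrib)
  show "inner (r *\<^sub>R x) y = r * inner x y"
    unfolding inner_fin_seq_superset[OF I sub(2)] xI
    by (simp add: scaleR_fin_seq.rep_eq algebra_simps sum_distrib_left)
  show "0 \<le> inner x x"
    unfolding inner_fin_seq_def by (rule sum_nonneg) simp
  show "inner x x = 0 \<longleftrightarrow> x = 0"
  proof
    assume "inner x x = 0"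
    then have "\<forall>i\<in>{i. coord x i \<noteq> 0}. coord x i * coord x i = 0"
      unfolding inner_fin_seq_def by (subst (asm) sum_nonneg_eq_0_iff) (auto simp: finite_support)
    then show "x = 0" by (intro fin_seq_eqI) (auto simp: zero_fin_seq.rep_eq)
  qed (simp add: inner_fin_seq_def zero_fin_seq.rep_eq)
qed

end

definition Rn :: "nat \<Rightarrow> fin_seq set" where
  "Rn d = {x. \<forall>i\<ge>d. coord x i = 0}"

lemma inner_Rn: "x \<in> Rn d \<Longrightarrow> inner x y = (\<Sum>i<d. coord x i * coord y i)"
  by (rule inner_fin_seq_superset) (force simp: Rn_def not_le[symmetric])+

lemma norm_Rn: "x \<in> Rn d \<Longrightarrow> norm x = sqrt (\<Sum>i<d. (coord x i)\<^sup>2)"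
  by (simp add: norm_eq_sqrt_inner inner_Rn power2_eq_square)

lemma subspace_Rn: "subspace (Rn d)"
  by (simp add: subspace_def Rn_def zero_fin_seq.rep_eq plus_fin_seq.rep_eq scaleR_fin_seq.rep_eq)

lemma bij_betw_coord_Rn: "bij_betw coord (Rn d) {x. \<forall>i\<ge>d. x i = 0}"
proof (rule bij_betw_imageI)
  show "inj_on coord (Rn d)" by (rule inj_onI) (simp add: coord_inject)
  show "coord ` Rn d = {x. \<forall>i\<ge>d. x i = 0}"
  proof safe
    fix x :: "nat \<Rightarrow> real" assume x: "\<forall>i\<ge>d. x i = 0"
    have "finite {i. x i \<noteq> 0}" by (rule finite_subset[of _ "{..<d}"]) (use x in \<open>force simp: not_le[symmetric]\<close>)+
    then have "coord (Abs_fin_seq x) = x" by (simp add: Abs_fin_seq_inverse)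
    with x show "x \<in> coord ` Rn d" by (intro image_eqI[of _ _ "Abs_fin_seq x"]) (auto simp: Rn_def)
  qed (simp add: Rn_def)
qed

text \<open>
  In what follows \<open>V\<close> is the domain \<open>\<real>\<^sup>d\<close>, that is, \<open>Rn d\<close>.  A \<open>d \<times> d\<close> matrix is rendered as a linear
  operator of which only the restriction to \<open>V\<close> matters (every linear map \<open>V \<rightarrow> V\<close> extends to the
  whole type).
\<close>

definition op_norm_on :: "'a::real_normed_vector set \<Rightarrow> ('a \<Rightarrow> 'a) \<Rightarrow> real" where
  "op_norm_on V A = (SUP u\<in>{u\<in>V. norm u \<le> 1}. norm (A u))"

definition symmetric_on :: "'a::real_inner set \<Rightarrow> ('a \<Rightarrow> 'a) \<Rightarrow> bool" where
  "symmetric_on V A \<longleftrightarrow> linear A \<and> A ` V \<subseteq> V \<and> (\<forall>u\<in>V. \<forall>v\<in>V. inner (A u) v = inner u (A v))"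

definition pos_def_on :: "'a::real_inner set \<Rightarrow> ('a \<Rightarrow> 'a) \<Rightarrow> bool" where
  "pos_def_on V A \<longleftrightarrow> (\<forall>u\<in>V. u \<noteq> 0 \<longrightarrow> inner (A u) u > 0)"

text \<open>\<open>f\<close> is \<open>C\<^sup>2\<close> on \<open>V\<close> with gradient \<open>g\<close> and Hessian \<open>G\<close> (both determined by \<open>f\<close> on \<open>V\<close>).\<close>

definition C2_on ::
  "'a::real_inner set \<Rightarrow> ('a \<Rightarrow> real) \<Rightarrow> ('a \<Rightarrow> 'a) \<Rightarrow> ('a \<Rightarrow> 'a \<Rightarrow> 'a) \<Rightarrow> bool" where
  "C2_on V f g G \<longleftrightarrow>
     (\<forall>x\<in>V. g x \<in> V \<and>
        (f has_derivative (\<lambda>h. inner (g x) h)) (at x within V) \<and>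
        (g has_derivative G x) (at x within V) \<and>
        ((\<lambda>y. op_norm_on V (\<lambda>u. G y u - G x u)) \<longlongrightarrow> 0) (at x within V))"

definition global_hessian_smooth ::
  "'a::real_inner set \<Rightarrow> ('a \<Rightarrow> 'a) \<Rightarrow> ('a \<Rightarrow> 'a \<Rightarrow> 'a) \<Rightarrow> real \<Rightarrow> real \<Rightarrow> bool" where
  "global_hessian_smooth V g G M0 M1 \<longleftrightarrow>
     (\<forall>x\<in>V. \<forall>y\<in>V.
        op_norm_on V (\<lambda>u. G y u - G x u) \<le> (M0 + M1 * norm (g x)) * norm (y - x))"

definition local_hessian_smooth ::
  "'a::real_inner set \<Rightarrow> ('a \<Rightarrow> 'a) \<Rightarrow> ('a \<Rightarrow> 'a \<Rightarrow> 'a) \<Rightarrow> real \<Rightarrow> real \<Rightarrow> real \<Rightarrow> bool" where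
  "local_hessian_smooth V g G M0 M1 r \<longleftrightarrow>
     (\<forall>x\<in>V. \<forall>y\<in>V. norm (y - x) \<le> r \<longrightarrow>
        op_norm_on V (\<lambda>u. G y u - G x u) \<le> (M0 + M1 * norm (g x)) * norm (y - x))"

definition ms_accepts ::
  "'a::real_inner set \<Rightarrow> ('a \<Rightarrow> 'a) \<Rightarrow> ('a \<Rightarrow> 'a \<Rightarrow> 'a) \<Rightarrow> 'a \<Rightarrow> real \<Rightarrow> 'a \<Rightarrow> bool" where
  "ms_accepts V g H x \<tau> s \<longleftrightarrow>
     pos_def_on V (\<lambda>u. H x u + \<tau> *\<^sub>R u) \<and>
     s \<in> V \<and> H x s + \<tau> *\<^sub>R s = - g x \<and>
     norm (g (x + s) + \<tau> *\<^sub>R s) \<le> \<tau> / 2 * norm s"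

text \<open>
  Big-step semantics: \<open>ms_backtrack V g H x \<tau> x' \<tau>'\<close> holds iff \<open>MSBacktrack(x,\<tau>)\<close> terminates and
  returns \<open>(x', \<tau>')\<close>.  By positive definiteness the step \<open>s\<close> is unique, so the result is too.
\<close>

inductive ms_backtrack ::
  "'a::real_inner set \<Rightarrow> ('a \<Rightarrow> 'a) \<Rightarrow> ('a \<Rightarrow> 'a \<Rightarrow> 'a) \<Rightarrow> 'a \<Rightarrow> real \<Rightarrow> 'a \<Rightarrow> real \<Rightarrow> bool"
  for V g H x where
  accept: "ms_accepts V g H x \<tau> s \<Longrightarrow> ms_backtrack V g H x \<tau> (x + s) \<tau>"
| reject: "\<nexists>s. ms_accepts V g H x \<tau> s \<Longrightarrow> ms_backtrack V g H x (2 * \<tau>) x' \<tau>' \<Longrightarrow>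
    ms_backtrack V g H x \<tau> x' \<tau>'"

text \<open>
  \<open>arn_iterate V g H x0 \<eta>0 k x \<eta>\<close> holds iff the method started from \<open>x0\<close>, \<open>\<eta>0\<close> reaches
  \<open>x\<^sub>k = x\<close>, \<open>\<eta>\<^sub>k = \<eta>\<close>; no iterate is generated after a point with zero gradient.
\<close>

inductive arn_iterate ::
  "'a::real_inner set \<Rightarrow> ('a \<Rightarrow> 'a) \<Rightarrow> ('a \<Rightarrow> 'a \<Rightarrow> 'a) \<Rightarrow> 'a \<Rightarrow> real \<Rightarrow> nat \<Rightarrow> 'a \<Rightarrow> real \<Rightarrow> bool"
  for V g H x0 \<eta>0 where
  start: "arn_iterate V g H x0 \<eta>0 0 x0 \<eta>0"
| step: "arn_iterate V g H x0 \<eta>0 k x \<eta> \<Longrightarrow> g x \<noteq> 0 \<Longrightarrow> ms_backtrack V g H x \<eta> x' \<tau> \<Longrightarrow>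
    arn_iterate V g H x0 \<eta>0 (Suc k) x' (\<tau> / 2 * min 1 (norm (g x') / norm (g x)))"

lemma ms_accepts_unique:
  assumes V: "subspace V" and lin: "linear (H x)"
    and acc: "ms_accepts V g H x \<tau> s" "ms_accepts V g H x \<tau> s'"
  shows "s = s'"
proof (rule ccontr)
  assume "s \<noteq> s'"
  moreover have "s - s' \<in> V" using V acc by (simp add: ms_accepts_def subspace_diff)
  ultimately have "inner (H x (s - s') + \<tau> *\<^sub>R (s - s')) (s - s') > 0"
    using acc(1) by (auto simp: ms_accepts_def pos_def_on_def)
  moreover have "H x (s - s') + \<tau> *\<^sub>R (s - s') = (H x s + \<tau> *\<^sub>R s) - (H x s' + \<tau> *\<^sub>R s')"
    by (simp add: linear_diff[OF lin] algebra_simps)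
  then have "H x (s - s') + \<tau> *\<^sub>R (s - s') = 0"
    using acc by (simp add: ms_accepts_def)
  ultimately show False by simp
qed

definition log_plus :: "real \<Rightarrow> real" where
  "log_plus t = (if t = 0 then 0 else max 0 (ln t))"

text \<open>Only used for arguments \<open>\<ge> 1\<close>, possibly \<open>\<infinity>\<close>.\<close>

definition log_ereal :: "ereal \<Rightarrow> ereal" where
  "log_ereal t = (if t = \<infinity> then \<infinity> else ereal (ln (real_of_ereal t)))"

text \<open>
  \<open>\<rho> = \<infinity>\<close> in the global case, so that \<open>2D/\<rho> = 0\<close>.  Division on \<^typ>\<open>ereal\<close> satisfies
  \<open>a / \<infinity> = 0\<close> for finite \<open>a\<close> and \<open>a / 0 = \<infinity>\<close> for \<open>a > 0\<close>; also \<open>0 / 0 = 0\<close>.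
\<close>

definition B_const :: "real \<Rightarrow> ereal \<Rightarrow> real \<Rightarrow> real" where
  "B_const D \<rho> M1 = max 1 (max (real_of_ereal (ereal (2 * D) / \<rho>)) (6 * sqrt M1 * D))"

definition eps_tr :: "real \<Rightarrow> real \<Rightarrow> real \<Rightarrow> real \<Rightarrow> real" where
  "eps_tr D B M0 \<delta> = max (M0 * D ^ 3 / B ^ 2) (\<delta> * D ^ 2 / B)"

text \<open>\<open>gn\<close> is the norm of the gradient at the starting point.\<close>

definition ell0 :: "real \<Rightarrow> real \<Rightarrow> real \<Rightarrow> real \<Rightarrow> real \<Rightarrow> ereal" where
  "ell0 D B \<epsilon>tr gn \<eta>0 =
     max 1 (max (ereal (2 * D * gn) / ereal \<epsilon>tr)
                (ereal (\<eta>0 * D ^ 2) / ereal (sqrt 6 * B * \<epsilon>tr)))"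

end

theory Submission
  imports Defs
begin

text \<open>
  Write \<open>a\<close> for the gradient norm and \<open>\<Delta>\<close> for the gap \<open>f x - f xstar\<close> at the current iterate, and put
  \<open>T a = max (4 \<delta>) (max (B a / D) (sqrt (8 M0 a)))\<close>.  Every trial with \<open>\<tau> \<ge> T a\<close> is accepted
  (\<open>accepts_above_threshold\<close>), so the accepted regularization satisfies \<open>\<tau> \<le> max \<eta> (2 T a)\<close>.  An
  accepted step is an approximate proximal step; convexity gives \<open>\<Delta> - \<Delta>' \<ge> a'\<^sup>2 / (2 \<tau>)\<close> and
  \<open>a' \<le> 2 a\<close> (\<open>accepted_step\<close>), and boundedness of the sublevel set gives \<open>\<Delta> \<le> 2 D a\<close>.

  Because \<open>T a\<close> is nondecreasing and \<open>T a / a\<close> nonincreasing in \<open>a\<close>, the update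
  \<open>\<eta>' = \<tau> / 2 * min 1 (a' / a)\<close> guarantees \<open>\<eta>' / T a' \<le> (\<tau> / 2) / T a\<close>.  Thus an excessive
  regularization halves relative to \<open>T\<close> in each step until \<open>\<tau> \<le> 2 T a\<close>, and this bound then persists.
  From there on, a step either halves the gradient norm, or has \<open>T a \<le> 2 T a'\<close> and hence
  \<open>\<Delta> - \<Delta>' \<ge> a'\<^sup>2 / (8 T a')\<close>.  In the latter case \<open>a' \<ge> \<Delta>' / (2 D)\<close> yields, up to constants, a
  decrease of at least \<open>\<Delta>' / B\<close>, \<open>\<Delta>'\<close> to the power \<open>3 / 2\<close> over \<open>sqrt (M0 D\<^sup>3)\<close>, or
  \<open>\<Delta>'\<^sup>2 / (\<delta> D\<^sup>2)\<close>, depending on the entry that attains the maximum in \<open>T a'\<close>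
  (\<open>descent_regimes\<close>).

  The gradient norm may also grow, so steps of different kinds cannot be counted separately.
  Instead a single potential combines the logarithms of \<open>a\<close>, of \<open>\<eta> / T a\<close> and of \<open>\<Delta>\<close> with
  \<open>B ln (max \<Delta> m)\<close>, \<open>- sqrt (M0 D\<^sup>3) / sqrt \<Delta>\<close> and \<open>- \<delta> D\<^sup>2 / \<Delta>\<close>, where \<open>m\<close> is the maximum of
  the target accuracy and the transition gap.  It drops by at least \<open>1\<close> in every step that leaves the
  gap above the target (\<open>method_step\<close>), so the number of steps is at most its total decrease, which
  is estimated in \<open>potential_difference\<close> and \<open>startup_logs\<close>.
\<close>

section \<open>Linear maps on the coordinate space\<close>

lift_definition unit_seq :: "nat \<Rightarrow> fin_seq" is "\<lambda>i j. if j = i then 1 else 0"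
  by (rule finite_subset[of _ "{i}" for i]) auto

lemma unit_seq_in_Rn: "i < d \<Longrightarrow> unit_seq i \<in> Rn d"
  by (simp add: Rn_def unit_seq.rep_eq)

lemma inj_unit_seq: "inj unit_seq"
proof (rule injI)
  fix i j assume "unit_seq i = unit_seq j"
  then have "coord (unit_seq i) i = coord (unit_seq j) i" by simp
  then show "i = j" by (simp add: unit_seq.rep_eq split: if_splits)
qed

lemma coord_sum: "coord (sum h I) j = (\<Sum>i\<in>I. coord (h i) j)"
  by (induction I rule: infinite_finite_induct) (auto simp: zero_fin_seq.rep_eq plus_fin_seq.rep_eq)

lemma coord_unit_combination:
  assumes "finite I"
  shows "coord (\<Sum>i\<in>I. c i *\<^sub>R unit_seq i) j = (if j \<in> I then c j else 0)"
proof -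
  have "coord (\<Sum>i\<in>I. c i *\<^sub>R unit_seq i) j = (\<Sum>i\<in>I. if j = i then c i else 0)"
    unfolding coord_sum
    by (intro sum.cong) (auto simp: scaleR_fin_seq.rep_eq unit_seq.rep_eq)
  then show ?thesis using assms by (simp add: sum.delta)
qed

lemma Rn_expansion:
  assumes "u \<in> Rn d"
  shows "u = (\<Sum>i<d. coord u i *\<^sub>R unit_seq i)"
  using assms by (intro fin_seq_eqI) (auto simp: coord_unit_combination Rn_def)

lemma abs_coord_le_norm:
  assumes "u \<in> Rn d"
  shows "\<bar>coord u i\<bar> \<le> norm u"
proof (cases "i < d")
  case True
  have "(coord u i)\<^sup>2 \<le> (\<Sum>j<d. (coord u j)\<^sup>2)"
    using True by (intro member_le_sum) auto
  then show ?thesis using assms by (simp add: norm_Rn real_le_rsqrt)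
qed (use assms in \<open>simp add: Rn_def\<close>)

lemma linear_bounded_on_Rn:
  fixes A :: "fin_seq \<Rightarrow> 'b::real_normed_vector"
  assumes A: "linear A"
  shows "\<exists>K. \<forall>u\<in>Rn d. norm (A u) \<le> K * norm u"
proof (intro exI ballI)
  fix u assume u: "u \<in> Rn d"
  have "A u = (\<Sum>i<d. coord u i *\<^sub>R A (unit_seq i))"
    by (subst Rn_expansion[OF u]) (simp add: linear_sum[OF A] linear_scale[OF A])
  also have "norm \<dots> \<le> (\<Sum>i<d. norm u * norm (A (unit_seq i)))"
    by (rule sum_norm_le) (simp add: abs_coord_le_norm[OF u] mult_right_mono)
  also have "\<dots> = (\<Sum>i<d. norm (A (unit_seq i))) * norm u"
    by (simp add: sum_distrib_left mult.commute)
  finally show "norm (A u) \<le> (\<Sum>i<d. norm (A (unit_seq i))) * norm u" .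
qed

lemma bdd_above_norm_unit_ball:
  assumes A: "linear A"
  shows "bdd_above ((\<lambda>u. norm (A u)) ` {u\<in>Rn d. norm u \<le> 1})"
proof -
  obtain K where K: "\<And>u. u \<in> Rn d \<Longrightarrow> norm (A u) \<le> K * norm u"
    using linear_bounded_on_Rn[OF A] by blast
  show ?thesis
  proof (rule bdd_aboveI2)
    fix v assume v: "v \<in> {u\<in>Rn d. norm u \<le> 1}"
    then have "norm (A v) \<le> K * norm v" using K by blast
    also have "\<dots> \<le> \<bar>K\<bar> * 1" using v by (intro mult_mono) auto
    finally show "norm (A v) \<le> \<bar>K\<bar> * 1" .
  qed
qed

lemma norm_le_op_norm_on:
  assumes A: "linear A" and u: "u \<in> Rn d"
  shows "norm (A u) \<le> op_norm_on (Rn d) A * norm u"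
proof (cases "u = 0")
  case False
  let ?v = "(1 / norm u) *\<^sub>R u"
  have "?v \<in> {u\<in>Rn d. norm u \<le> 1}"
    using u False by (simp add: subspace_scale[OF subspace_Rn])
  then have "norm (A ?v) \<le> op_norm_on (Rn d) A"
    unfolding op_norm_on_def by (intro cSUP_upper[OF _ bdd_above_norm_unit_ball[OF A]])
  then show ?thesis using False by (simp add: linear_scale[OF A] field_simps)
qed (simp add: linear_0[OF A])

lemma op_norm_on_nonneg:
  assumes A: "linear A"
  shows "0 \<le> op_norm_on (Rn d) A"
proof -
  have "norm (A 0) \<le> op_norm_on (Rn d) A"
    unfolding op_norm_on_def
    by (intro cSUP_upper[OF _ bdd_above_norm_unit_ball[OF A]]) (simp add: subspace_0[OF subspace_Rn])
  then show ?thesis by (simp add: linear_0[OF A])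
qed

text \<open>
  Positive definiteness makes \<open>A\<close> injective on \<open>Rn d\<close>, so the images of the \<open>d\<close> unit vectors are
  independent; a vector outside their span would give \<open>d + 1\<close> independent vectors in a
  \<open>d\<close>-dimensional space.  This is what makes the regularized Newton system solvable.
\<close>

lemma pos_def_surj:
  assumes A: "linear A" and into: "A ` Rn d \<subseteq> Rn d" and pd: "pos_def_on (Rn d) A"
    and y: "y \<in> Rn d"
  shows "\<exists>s\<in>Rn d. A s = y"
proof -
  let ?E = "unit_seq ` {..<d}"
  have finE: "finite ?E" by simp
  have cardE: "card ?E = d" using inj_unit_seq by (simp add: card_image inj_on_subset)
  have span: "Rn d = span ?E"
  proof
    show "Rn d \<subseteq> span ?E"
    proof
      fix u assume "u \<in> Rn d"
      then have "u = (\<Sum>i<d. coord u i *\<^sub>R unit_seq i)" by (rule Rn_expansion)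
      then show "u \<in> span ?E" by (metis (no_types, lifting) imageI lessThan_iff span_base span_scale span_sum)
    qed
    show "span ?E \<subseteq> Rn d" using subspace_Rn unit_seq_in_Rn by (intro span_minimal) auto
  qed
  have indep: "independent ?E"
  proof (rule independent_if_scalars_zero[OF finE])
    fix h v assume h: "(\<Sum>x\<in>?E. h x *\<^sub>R x) = 0" and v: "v \<in> ?E"
    then obtain i where i: "i < d" "v = unit_seq i" by auto
    have "(\<Sum>x\<in>?E. h x *\<^sub>R x) = (\<Sum>i<d. h (unit_seq i) *\<^sub>R unit_seq i)"
      by (subst sum.reindex) (auto intro: inj_on_subset[OF inj_unit_seq])
    then have "coord (\<Sum>i<d. h (unit_seq i) *\<^sub>R unit_seq i) i = 0"
      using h by (simp add: zero_fin_seq.rep_eq)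
    then show "h v = 0" using i by (simp add: coord_unit_combination)
  qed
  have inj: "inj_on A (span ?E)"
    unfolding span[symmetric]
  proof (rule inj_onI)
    fix u v assume uv: "u \<in> Rn d" "v \<in> Rn d" "A u = A v"
    then have "A (u - v) = 0" by (simp add: linear_diff[OF A])
    moreover have "u - v \<in> Rn d" using uv subspace_Rn by (simp add: subspace_diff)
    ultimately show "u = v" using pd by (force simp: pos_def_on_def)
  qed
  have indA: "independent (A ` ?E)" by (rule linear_independent_injective_image[OF A indep inj])
  have injE: "inj_on A ?E" using inj span_superset by (rule inj_on_subset)
  have "y \<in> span (A ` ?E)"
  proof (rule ccontr)
    assume n: "y \<notin> span (A ` ?E)"
    then have "independent (insert y (A ` ?E))" using indA by (rule independent_insertI)
    moreover have "insert y (A ` ?E) \<subseteq> span ?E"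
      unfolding span[symmetric] using y into unit_seq_in_Rn by fast
    ultimately have "card (insert y (A ` ?E)) \<le> d"
      using independent_span_bound[OF finE, of "insert y (A ` ?E)"] cardE by simp
    moreover have "y \<notin> A ` ?E" using n span_base[of y "A ` ?E"] by argo
    then have "card (insert y (A ` ?E)) = Suc d"
      using card_insert_disjoint[OF finite_imageI[OF finE, of A], of y] card_image[OF injE] cardE by argo
    ultimately show False by simp
  qed
  then show ?thesis using linear_span_image[OF A, of ?E] span by auto
qed

section \<open>Convexity and Taylor bounds on a subspace\<close>

text \<open>
  Derivatives here are taken within a subspace that may have empty interior in the ambient type.
  Restricting to lines inside the subspace leads back to one-variable calculus.
\<close>

lemma has_vector_derivative_along_line:
  assumes V: "subspace V" and x: "x \<in> V" and h: "h \<in> V"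
    and F: "(F has_derivative F') (at (x + t *\<^sub>R h) within V)"
  shows "((\<lambda>t. F (x + t *\<^sub>R h)) has_vector_derivative F' h) (at t)"
proof -
  have "((\<lambda>t. x + t *\<^sub>R h) has_derivative (\<lambda>u. u *\<^sub>R h)) (at t)"
    by (auto intro!: derivative_eq_intros)
  moreover have "(F has_derivative F') (at (x + t *\<^sub>R h) within range (\<lambda>t. x + t *\<^sub>R h))"
    using V x h by (intro has_derivative_subset[OF F]) (auto intro: subspace_add subspace_scale)
  ultimately have "((\<lambda>t. F (x + t *\<^sub>R h)) has_derivative (\<lambda>u. F' (u *\<^sub>R h))) (at t)"
    by (rule has_derivative_in_compose)
  then show ?thesis
    using has_derivative_linear[OF F] by (simp add: has_vector_derivative_def linear_scale)
qed

lemma convex_above_tangent_on: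
  assumes V: "subspace V" and f: "convex_on V f" and x: "x \<in> V" and y: "y \<in> V"
    and g: "(f has_derivative (\<lambda>h. inner gx h)) (at x within V)"
  shows "f x + inner gx (y - x) \<le> f y"
proof -
  define h where "h = y - x"
  have h: "h \<in> V" using V x y by (simp add: h_def subspace_diff)
  have line: "x + t *\<^sub>R h \<in> V" for t using V x h by (simp add: subspace_add subspace_scale)
  have "convex_on UNIV (\<lambda>t. f (x + t *\<^sub>R h))"
  proof (rule convex_onI)
    fix t a b :: real assume t: "0 < t" "t < 1"
    have "x + ((1 - t) *\<^sub>R a + t *\<^sub>R b) *\<^sub>R h = (1 - t) *\<^sub>R (x + a *\<^sub>R h) + t *\<^sub>R (x + b *\<^sub>R h)"
      by (simp add: algebra_simps)
    then show "f (x + ((1 - t) *\<^sub>R a + t *\<^sub>R b) *\<^sub>R h)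
        \<le> (1 - t) * f (x + a *\<^sub>R h) + t * f (x + b *\<^sub>R h)"
      using convex_onD[OF f, of t] t line by simp
  qed simp
  moreover have "((\<lambda>t. f (x + t *\<^sub>R h)) has_field_derivative inner gx h) (at 0)"
    using has_vector_derivative_along_line[OF V x h, of f _ 0] g
    by (simp add: has_real_derivative_iff_has_vector_derivative)
  ultimately have "inner gx h * (1 - 0) \<le> f (x + 1 *\<^sub>R h) - f (x + 0 *\<^sub>R h)"
    by (intro convex_on_imp_above_tangent[of UNIV]) auto
  then show ?thesis by (simp add: h_def)
qed

lemma convex_gradient_monotone_on:
  assumes "subspace V" and "convex_on V f" and "x \<in> V" and "y \<in> V"
    and "(f has_derivative (\<lambda>h. inner gx h)) (at x within V)"
    and "(f has_derivative (\<lambda>h. inner gy h)) (at y within V)"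
  shows "0 \<le> inner (gy - gx) (y - x)"
  using convex_above_tangent_on[OF assms(1-5)]
    convex_above_tangent_on[OF assms(1,2,4,3,6)]
  by (simp add: algebra_simps inner_diff_left inner_diff_right)

text \<open>
  By monotonicity of the gradient, \<open>t \<mapsto> inner (g (x + t h)) h\<close> cannot decrease to the right of \<open>0\<close>.
\<close>

lemma convex_hessian_nonneg_on:
  assumes V: "subspace V" and f: "convex_on V f" and x: "x \<in> V" and h: "h \<in> V"
    and g: "\<And>z. z \<in> V \<Longrightarrow> (f has_derivative (\<lambda>h. inner (g z) h)) (at z within V)"
    and G: "(g has_derivative Gx) (at x within V)"
  shows "0 \<le> inner (Gx h) h"
proof -
  have line: "x + t *\<^sub>R h \<in> V" for t using V x h by (simp add: subspace_add subspace_scale)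
  have "((\<lambda>t. g (x + t *\<^sub>R h)) has_vector_derivative Gx h) (at 0)"
    using has_vector_derivative_along_line[OF V x h, of g _ 0] G by simp
  then have "((\<lambda>t. inner (g (x + t *\<^sub>R h)) h) has_vector_derivative inner (Gx h) h) (at 0)"
    by (rule bounded_linear.has_vector_derivative[OF bounded_linear_inner_left])
  then have d: "((\<lambda>t. inner (g (x + t *\<^sub>R h)) h) has_real_derivative inner (Gx h) h) (at 0)"
    by (simp add: has_real_derivative_iff_has_vector_derivative)
  show ?thesis
  proof (rule ccontr)
    assume "\<not> ?thesis"
    then obtain e where e: "0 < e"
      "\<And>t. 0 < t \<Longrightarrow> t < e \<Longrightarrow> inner (g (x + t *\<^sub>R h)) h < inner (g (x + 0 *\<^sub>R h)) h"
      using DERIV_neg_dec_right[OF d] by force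
    have "0 \<le> inner (g (x + (e/2) *\<^sub>R h) - g x) (x + (e/2) *\<^sub>R h - x)"
      by (intro convex_gradient_monotone_on[OF V f x] g line x)
    then have "0 \<le> (e/2) * (inner (g (x + (e/2) *\<^sub>R h)) h - inner (g x) h)"
      by (simp add: inner_diff_left)
    then show False using e(2)[of "e/2"] e(1) by (simp add: zero_le_mult_iff)
  qed
qed

text \<open>
  Taylor's remainder bound, with the Lipschitz condition on the Hessian entering only along the
  segment: the derivative of \<open>g (x + t s) - t G x s\<close> is at most \<open>t K\<close> in norm, and \<open>t K\<close> integrates
  to \<open>K / 2\<close>.
\<close>

lemma gradient_linearization_error:
  assumes V: "subspace V" and x: "x \<in> V" and s: "s \<in> V"
    and G: "\<And>z. z \<in> V \<Longrightarrow> (g has_derivative G z) (at z within V)"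
    and L: "\<And>t. 0 < t \<Longrightarrow> t < 1 \<Longrightarrow> norm (G (x + t *\<^sub>R s) s - G x s) \<le> t * K"
  shows "norm (g (x + s) - g x - G x s) \<le> K / 2"
proof -
  have line: "x + t *\<^sub>R s \<in> V" for t using V x s by (simp add: subspace_add subspace_scale)
  define \<phi> where "\<phi> t = g (x + t *\<^sub>R s) - t *\<^sub>R G x s" for t
  have d: "(\<phi> has_vector_derivative G (x + t *\<^sub>R s) s - G x s) (at t)" for t
    unfolding \<phi>_def
    by (auto intro!: derivative_eq_intros has_vector_derivative_along_line[OF V x s G] line)
  have c: "continuous_on {0..1} \<phi>"
    by (intro continuous_at_imp_continuous_on ballI has_vector_derivative_continuous[OF d])
  have "norm (\<phi> 1 - \<phi> 0) \<le> 1\<^sup>2 / 2 * K - 0\<^sup>2 / 2 * K"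
    by (rule differentiable_bound_general[where f = \<phi> and \<phi> = "\<lambda>t. t\<^sup>2 / 2 * K" and \<phi>' = "\<lambda>t. t * K", OF _ c _ d])
      (auto intro!: continuous_intros derivative_eq_intros L
        simp: has_real_derivative_iff_has_vector_derivative[symmetric])
  then show ?thesis by (simp add: \<phi>_def algebra_simps)
qed

section \<open>One step of the method\<close>

text \<open>
  The global and the local smoothness conditions are treated together: the argument compares
  Hessians only at distance at most \<open>2 D / B\<close>, and \<open>B \<ge> 2 D / \<rho>\<close> makes this radius admissible in
  the local case.
\<close>

locale newton_problem =
  fixes d :: nat and f :: "fin_seq \<Rightarrow> real" and g :: "fin_seq \<Rightarrow> fin_seq"
    and G H :: "fin_seq \<Rightarrow> fin_seq \<Rightarrow> fin_seq" and xstar x0 :: fin_seq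
    and \<delta> M0 M1 D B :: real
  assumes convex: "convex_on (Rn d) f"
    and C2: "C2_on (Rn d) f g G"
    and xstar: "xstar \<in> Rn d"
    and minimizer: "x \<in> Rn d \<Longrightarrow> f xstar \<le> f x"
    and H_symmetric: "x \<in> Rn d \<Longrightarrow> symmetric_on (Rn d) (H x)"
    and H_close: "x \<in> Rn d \<Longrightarrow> op_norm_on (Rn d) (\<lambda>u. H x u - G x u) \<le> \<delta>"
    and M0: "0 \<le> M0" and M1: "0 \<le> M1"
    and smooth: "x \<in> Rn d \<Longrightarrow> y \<in> Rn d \<Longrightarrow> norm (y - x) \<le> 2 * D / B \<Longrightarrow>
      op_norm_on (Rn d) (\<lambda>u. G y u - G x u) \<le> (M0 + M1 * norm (g x)) * norm (y - x)"
    and x0: "x0 \<in> Rn d"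
    and level: "x \<in> Rn d \<Longrightarrow> f x \<le> f x0 \<Longrightarrow> norm (x - x0) \<le> D"
    and D: "0 < D" and B: "1 \<le> B" and B_M1: "6 * sqrt M1 * D \<le> B"
begin

abbreviation V :: "fin_seq set" where "V \<equiv> Rn d"

abbreviation gap :: "fin_seq \<Rightarrow> real" where "gap x \<equiv> f x - f xstar"

text \<open>
  Backtracking stops once the regularization reaches this value, where \<open>a\<close> is the current gradient
  norm.  The three entries absorb the Hessian error \<open>\<delta>\<close>, the smoothness term \<open>M1 a\<close> together with the
  trust radius \<open>2 D / B\<close>, and the smoothness term \<open>M0\<close>.
\<close>

definition threshold :: "real \<Rightarrow> real" where
  "threshold a = max (4 * \<delta>) (max (B * a / D) (sqrt (8 * M0 * a)))"

lemma gradient_in_V: "x \<in> V \<Longrightarrow> g x \<in> V"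
  and f_derivative: "x \<in> V \<Longrightarrow> (f has_derivative (\<lambda>h. inner (g x) h)) (at x within V)"
  and g_derivative: "x \<in> V \<Longrightarrow> (g has_derivative G x) (at x within V)"
  using C2 by (auto simp: C2_on_def)

lemma G_linear: "x \<in> V \<Longrightarrow> linear (G x)"
  using g_derivative has_derivative_linear by blast

lemma H_linear: "x \<in> V \<Longrightarrow> linear (H x)" and H_into: "x \<in> V \<Longrightarrow> H x ` V \<subseteq> V"
  using H_symmetric by (auto simp: symmetric_on_def)

lemma H_error:
  assumes "x \<in> V" "u \<in> V"
  shows "norm (H x u - G x u) \<le> \<delta> * norm u"
proof -
  have "norm (H x u - G x u) \<le> op_norm_on V (\<lambda>u. H x u - G x u) * norm u"
    using assms by (intro norm_le_op_norm_on linear_compose_sub H_linear G_linear)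
  also have "\<dots> \<le> \<delta> * norm u" using H_close[OF assms(1)] by (intro mult_right_mono) auto
  finally show ?thesis .
qed

lemma delta_nonneg: "0 \<le> \<delta>"
  using op_norm_on_nonneg[OF linear_compose_sub[OF H_linear G_linear], OF x0 x0, of d] H_close[OF x0]
  by linarith

lemma tangent: "x \<in> V \<Longrightarrow> y \<in> V \<Longrightarrow> f x + inner (g x) (y - x) \<le> f y"
  by (rule convex_above_tangent_on[OF subspace_Rn convex _ _ f_derivative])

lemma gradient_monotone: "x \<in> V \<Longrightarrow> y \<in> V \<Longrightarrow> 0 \<le> inner (g y - g x) (y - x)"
  by (rule convex_gradient_monotone_on[OF subspace_Rn convex _ _ f_derivative f_derivative])

lemma H_lower_bound:
  assumes "x \<in> V" "u \<in> V"
  shows "- \<delta> * (norm u)\<^sup>2 \<le> inner (H x u) u"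
proof -
  have "0 \<le> inner (G x u) u"
    by (rule convex_hessian_nonneg_on[OF subspace_Rn convex assms f_derivative g_derivative[OF assms(1)]])
  moreover have "- inner (H x u - G x u) u \<le> norm (H x u - G x u) * norm u"
    using norm_cauchy_schwarz[of "- (H x u - G x u)" u] by (simp only: inner_minus_left norm_minus_cancel)
  moreover have "norm (H x u - G x u) * norm u \<le> \<delta> * norm u * norm u"
    using H_error[OF assms] by (rule mult_right_mono) simp
  ultimately show ?thesis by (simp add: inner_diff_left power2_eq_square)
qed

lemma linearization_error:
  assumes x: "x \<in> V" and s: "s \<in> V" and small: "norm s \<le> 2 * D / B"
  shows "norm (g (x + s) - g x - G x s) \<le> (M0 + M1 * norm (g x)) * (norm s)\<^sup>2 / 2"
proof (rule gradient_linearization_error[OF subspace_Rn x s g_derivative])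
  fix t :: real assume t: "0 < t" "t < 1"
  let ?y = "x + t *\<^sub>R s"
  have y: "?y \<in> V" using x s subspace_Rn by (simp add: subspace_add subspace_scale)
  have "norm (?y - x) \<le> 1 * norm s" using t by (simp add: mult_left_le_one_le)
  then have "norm (?y - x) \<le> 2 * D / B" using small by linarith
  note sm = smooth[OF x y this]
  have "norm (G ?y s - G x s) \<le> op_norm_on V (\<lambda>u. G ?y u - G x u) * norm s"
    using x y s by (intro norm_le_op_norm_on linear_compose_sub G_linear)
  also have "\<dots> \<le> (M0 + M1 * norm (g x)) * norm (?y - x) * norm s"
    using sm by (rule mult_right_mono) simp
  finally show "norm (G ?y s - G x s) \<le> t * ((M0 + M1 * norm (g x)) * (norm s)\<^sup>2)"
    using t by (simp add: power2_eq_square algebra_simps)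
qed

text \<open>
  The threshold increases in \<open>a\<close>, but at most proportionally to \<open>a\<close>.  These two facts say that
  the rule \<open>\<eta>' = \<tau> / 2 * min 1 (a' / a)\<close> carries a bound by the threshold at \<open>a\<close> over to a bound by
  the threshold at \<open>a'\<close>, whether the gradient norm grows or shrinks.
\<close>

lemma threshold_mono: "0 \<le> a \<Longrightarrow> a \<le> b \<Longrightarrow> threshold a \<le> threshold b"
  unfolding threshold_def using M0 B D
  by (intro max.mono order.refl divide_right_mono mult_left_mono real_sqrt_le_mono) auto

lemma threshold_ratio:
  assumes "0 \<le> a" "a \<le> b"
  shows "threshold b * a \<le> threshold a * b"
proof -
  have "sqrt b * a = sqrt a * (sqrt a * sqrt b)" using assms by simp
  also have "\<dots> \<le> sqrt a * (sqrt b * sqrt b)"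
    using assms by (intro mult_left_mono mult_right_mono) auto
  also have "\<dots> = sqrt a * b" using assms by simp
  finally have "sqrt (8 * M0) * (sqrt b * a) \<le> sqrt (8 * M0) * (sqrt a * b)"
    using M0 by (intro mult_left_mono) auto
  then have 1: "sqrt (8 * M0 * b) * a \<le> sqrt (8 * M0 * a) * b"
    by (simp add: real_sqrt_mult mult_ac)
  have 2: "4 * \<delta> * a \<le> 4 * \<delta> * b" using assms delta_nonneg by (simp add: mult_left_mono)
  have 3: "B * b / D * a = B * a / D * b" by simp
  have "threshold b * a = max (4 * \<delta> * a) (max (B * b / D * a) (sqrt (8 * M0 * b) * a))"
    using assms by (simp add: threshold_def max_mult_distrib_right)
  also have "\<dots> \<le> max (4 * \<delta> * b) (max (B * a / D * b) (sqrt (8 * M0 * a) * b))"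
    by (intro max.mono 1 2 eq_refl 3)
  also have "\<dots> = threshold a * b"
    using assms by (simp add: threshold_def max_mult_distrib_right)
  finally show ?thesis .
qed

lemma threshold_pos: "0 < a \<Longrightarrow> 0 < threshold a"
  using B D by (simp add: threshold_def less_max_iff_disj)

lemma threshold_bounds:
  "4 * \<delta> \<le> threshold a" "B * a / D \<le> threshold a" "sqrt (8 * M0 * a) \<le> threshold a"
  by (simp_all add: threshold_def)

text \<open>
  Since the true Hessian is positive semidefinite, \<open>H x + \<tau> I\<close> dominates \<open>\<tau> / 2\<close> once \<open>\<tau> \<ge> 4 \<delta>\<close>, so the
  step has norm \<open>r \<le> 2 a / \<tau>\<close>, and \<open>B a / D \<le> \<tau>\<close> keeps it within the radius \<open>2 D / B\<close> on which the
  Hessian is controlled.  The residual \<open>g (x + s) + \<tau> s\<close> equals \<open>g (x + s) - g x - H x s\<close>,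
  which is at most \<open>(L r / 2 + \<delta>) r\<close> with \<open>L = M0 + M1 a\<close>; here \<open>\<delta> \<le> \<tau> / 4\<close>, and
  \<open>L r / 2 \<le> L a / \<tau> \<le> \<tau> / 4\<close> because \<open>4 L a \<le> \<tau>\<^sup>2\<close>.
\<close>

lemma accepts_above_threshold:
  assumes x: "x \<in> V" and \<tau>: "0 < \<tau>" and large: "threshold (norm (g x)) \<le> \<tau>"
  shows "\<exists>s. ms_accepts V g H x \<tau> s"
proof -
  let ?a = "norm (g x)" and ?A = "\<lambda>u. H x u + \<tau> *\<^sub>R u"
  have \<delta>: "4 * \<delta> \<le> \<tau>" and lin: "B * ?a / D \<le> \<tau>" and sq: "sqrt (8 * M0 * ?a) \<le> \<tau>"
    using large threshold_bounds[of ?a] by auto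
  have coercive: "\<tau> / 2 * (norm u)\<^sup>2 \<le> inner (?A u) u" if u: "u \<in> V" for u
  proof -
    have "\<tau> / 2 * (norm u)\<^sup>2 \<le> (\<tau> - \<delta>) * (norm u)\<^sup>2"
      using \<delta> \<tau> by (intro mult_right_mono) auto
    also have "\<dots> \<le> inner (?A u) u"
      using H_lower_bound[OF x u] by (simp add: inner_add_left power2_norm_eq_inner algebra_simps)
    finally show ?thesis .
  qed
  have pd: "pos_def_on V ?A"
    unfolding pos_def_on_def
  proof (intro ballI impI)
    fix u assume u: "u \<in> V" "u \<noteq> 0"
    have "0 < \<tau> / 2 * (norm u)\<^sup>2" using \<tau> u by simp
    then show "0 < inner (?A u) u" using coercive[OF u(1)] by linarith
  qed
  have linA: "linear ?A" using H_linear[OF x] by (intro linear_compose_add linear_compose_scale_right linear_id[unfolded id_def])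
  have "?A ` V \<subseteq> V" using H_into[OF x] subspace_Rn by (auto intro!: subspace_add subspace_scale)
  moreover have "- g x \<in> V" using gradient_in_V[OF x] subspace_Rn by (simp add: subspace_neg)
  ultimately obtain s where s: "s \<in> V" "?A s = - g x"
    using pos_def_surj[OF linA _ pd] by blast
  let ?r = "norm s"
  have "\<tau> / 2 * ?r\<^sup>2 \<le> inner (- g x) s" using coercive[OF s(1)] s(2) by simp
  also have "\<dots> \<le> ?a * ?r" using norm_cauchy_schwarz[of "- g x" s] by simp
  finally have "\<tau> * ?r * ?r \<le> 2 * ?a * ?r" by (simp add: power2_eq_square)
  then have step: "\<tau> * ?r \<le> 2 * ?a"
    by (cases "?r = 0") (auto simp: mult_le_cancel_right)
  have "\<tau> * ?r \<le> \<tau> * (2 * D / B)"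
  proof -
    have "B * ?a \<le> \<tau> * D" using lin D by (simp add: field_simps)
    then have "?a \<le> \<tau> * D / B" using B by (simp add: field_simps)
    then have "2 * ?a \<le> \<tau> * (2 * D / B)" using mult_left_mono[of ?a "\<tau> * D / B" 2] by (simp add: mult_ac)
    with step show ?thesis by (rule order_trans)
  qed
  then have small: "?r \<le> 2 * D / B" using \<tau> by (rule mult_left_le_imp_le)
  let ?L = "M0 + M1 * ?a"
  have "6 * sqrt M1 * ?a \<le> \<tau>"
  proof -
    have "6 * sqrt M1 * D * ?a / D \<le> B * ?a / D"
      using B_M1 D by (intro divide_right_mono mult_right_mono) auto
    then show ?thesis using lin D by simp
  qed
  then have "(6 * sqrt M1 * ?a)\<^sup>2 \<le> \<tau>\<^sup>2" using M1 by (intro power_mono) auto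
  then have q1: "36 * M1 * ?a\<^sup>2 \<le> \<tau>\<^sup>2" using M1 by (simp add: power_mult_distrib)
  have "(sqrt (8 * M0 * ?a))\<^sup>2 \<le> \<tau>\<^sup>2" using sq M0 by (intro power_mono) auto
  then have q0: "8 * M0 * ?a \<le> \<tau>\<^sup>2" using M0 by simp
  have "4 * ?L * ?a = 8 * M0 * ?a / 2 + 36 * M1 * ?a\<^sup>2 / 9"
    by (simp add: power2_eq_square algebra_simps)
  also have "\<dots> \<le> \<tau>\<^sup>2" using q0 q1 zero_le_power2[of \<tau>] by linarith
  finally have La: "4 * ?L * ?a \<le> \<tau> * \<tau>" by (simp add: power2_eq_square)
  have "\<tau> * (2 * ?L * ?r) = 2 * ?L * (\<tau> * ?r)" by simp
  also have "\<dots> \<le> 2 * ?L * (2 * ?a)" using step M0 M1 by (intro mult_left_mono) auto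
  also have "\<dots> = 4 * ?L * ?a" by (simp only: mult_ac)
  also note La
  finally have Lr: "2 * ?L * ?r \<le> \<tau>" using \<tau> by simp
  have "g (x + s) + \<tau> *\<^sub>R s = (g (x + s) - g x - G x s) - (H x s - G x s)"
    using s(2) by (simp add: algebra_simps eq_neg_iff_add_eq_0)
  then have "norm (g (x + s) + \<tau> *\<^sub>R s) \<le> norm (g (x + s) - g x - G x s) + norm (H x s - G x s)"
    by (metis norm_triangle_ineq4)
  also have "\<dots> \<le> ?L * ?r\<^sup>2 / 2 + \<delta> * ?r"
    using linearization_error[OF x s(1) small] H_error[OF x s(1)] by (rule add_mono)
  also have "\<dots> = (2 * ?L * ?r / 4 + \<delta>) * ?r" by (simp add: power2_eq_square algebra_simps)
  also have "\<dots> \<le> \<tau> / 2 * ?r"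
  proof (rule mult_right_mono)
    show "2 * ?L * ?r / 4 + \<delta> \<le> \<tau> / 2" using Lr \<delta> by argo
  qed simp
  finally have "norm (g (x + s) + \<tau> *\<^sub>R s) \<le> \<tau> / 2 * ?r" .
  then show ?thesis using pd s by (auto simp: ms_accepts_def)
qed

lemma backtrack_terminates:
  assumes x: "x \<in> V" and \<tau>: "0 < \<tau>"
  shows "\<exists>x' \<tau>'. ms_backtrack V g H x \<tau> x' \<tau>'"
proof -
  obtain n where n: "threshold (norm (g x)) < 2 ^ n * \<tau>"
  proof -
    obtain n where "threshold (norm (g x)) / \<tau> < 2 ^ n"
      using real_arch_pow[of 2] by auto
    then show ?thesis using \<tau> that by (simp add: field_simps)
  qed
  then show ?thesis using \<tau>
  proof (induction n arbitrary: \<tau>)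
    case 0
    then have "\<exists>s. ms_accepts V g H x \<tau> s" by (intro accepts_above_threshold[OF x]) auto
    then show ?case by (auto intro: ms_backtrack.accept)
  next
    case (Suc n)
    show ?case
    proof (cases "\<exists>s. ms_accepts V g H x \<tau> s")
      case True
      then show ?thesis by (auto intro: ms_backtrack.accept)
    next
      case False
      have "\<exists>x' \<tau>'. ms_backtrack V g H x (2 * \<tau>) x' \<tau>'"
        using Suc.prems by (intro Suc.IH) (auto simp: mult_ac)
      then show ?thesis using ms_backtrack.reject[OF False] by blast
    qed
  qed
qed

lemma backtrack_result:
  assumes "ms_backtrack V g H x \<tau> x' \<tau>'" and x: "x \<in> V" and "0 < \<tau>"
  shows "(\<exists>s. x' = x + s \<and> ms_accepts V g H x \<tau>' s) \<and> \<tau> \<le> \<tau>' \<and>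
    \<tau>' \<le> max \<tau> (2 * threshold (norm (g x)))"
  using assms(1,3)
proof induction
  case (accept \<tau> s)
  then show ?case by auto
next
  case (reject \<tau> x' \<tau>')
  have "\<tau> < threshold (norm (g x))"
    using accepts_above_threshold[OF x reject.prems] reject.hyps(1) by force
  then show ?case using reject by auto
qed

text \<open>
  The acceptance test says that \<open>x + s\<close> is an approximate proximal point of \<open>x\<close>.  Squaring it
  bounds \<open>- inner (g (x + s)) s\<close> from below.  Convexity turns this into a decrease of \<open>f\<close>, and
  monotonicity of the gradient into a bound on the growth of the gradient norm in terms of \<open>g x\<close>
  alone, whatever \<open>\<tau>\<close> is.
\<close>

lemma accepted_step:
  assumes x: "x \<in> V" and \<tau>: "0 < \<tau>" and acc: "ms_accepts V g H x \<tau> s"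
  shows "(norm (g (x + s)))\<^sup>2 / (2 * \<tau>) \<le> f x - f (x + s)"
    and "norm (g (x + s)) \<le> 2 * norm (g x)"
proof -
  let ?g' = "g (x + s)" and ?a' = "norm (g (x + s))" and ?r = "norm s"
  have s: "s \<in> V" and res: "norm (?g' + \<tau> *\<^sub>R s) \<le> \<tau> / 2 * ?r"
    using acc by (auto simp: ms_accepts_def)
  have x': "x + s \<in> V" using x s subspace_Rn by (simp add: subspace_add)
  have "(norm (?g' + \<tau> *\<^sub>R s))\<^sup>2 \<le> (\<tau> / 2 * ?r)\<^sup>2" using res by (intro power_mono) auto
  then have "?a'\<^sup>2 + 2 * \<tau> * inner ?g' s + \<tau>\<^sup>2 * ?r\<^sup>2 \<le> \<tau>\<^sup>2 * ?r\<^sup>2 / 4"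
    by (simp add: power2_norm_eq_inner inner_add_left inner_add_right inner_commute
        power_mult_distrib power_divide) (simp add: algebra_simps power2_eq_square)
  then have key: "?a'\<^sup>2 + 3 / 4 * (\<tau> * ?r)\<^sup>2 \<le> 2 * \<tau> * (- inner ?g' s)"
    by (simp add: power_mult_distrib)
  then have "?a'\<^sup>2 \<le> 2 * \<tau> * (- inner ?g' s)"
    using zero_le_power2[of "\<tau> * ?r"] by linarith
  then have "?a'\<^sup>2 / (2 * \<tau>) \<le> - inner ?g' s" using \<tau> by (simp add: field_simps)
  also have "\<dots> \<le> f x - f (x + s)" using tangent[OF x' x] by simp
  finally show "?a'\<^sup>2 / (2 * \<tau>) \<le> f x - f (x + s)" .
  show "?a' \<le> 2 * norm (g x)"
  proof (cases "s = 0")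
    case False
    have "- inner ?g' s \<le> - inner (g x) s"
      using gradient_monotone[OF x x'] by (simp add: inner_diff_left)
    also have "\<dots> \<le> norm (g x) * ?r" using norm_cauchy_schwarz[of "- g x" s] by simp
    finally have "2 * \<tau> * (- inner ?g' s) \<le> 2 * \<tau> * (norm (g x) * ?r)"
      using \<tau> by (intro mult_left_mono) auto
    moreover have "p * q \<le> p\<^sup>2 + 3 / 4 * q\<^sup>2" for p q :: real
    proof -
      have "p * q \<le> p\<^sup>2 + q\<^sup>2 / 4"
        using zero_le_power2[of "p - q / 2"] by (simp add: power2_diff power_divide)
      then show ?thesis using zero_le_power2[of q] by linarith
    qed
    from this[of ?a' "\<tau> * ?r"]
    have "?a' * (\<tau> * ?r) \<le> ?a'\<^sup>2 + 3 / 4 * (\<tau> * ?r)\<^sup>2" .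
    ultimately have "?a' * (\<tau> * ?r) \<le> 2 * \<tau> * (norm (g x) * ?r)"
      using key by linarith
    then have "(\<tau> * ?r) * ?a' \<le> (\<tau> * ?r) * (2 * norm (g x))" by (simp only: mult_ac)
    then show ?thesis using \<tau> False by simp
  qed (simp)
qed

text \<open>
  The point \<open>x\<close> and the minimizer both lie within \<open>D\<close> of \<open>x0\<close>, so convexity along the segment
  joining them gives the factor \<open>2 D\<close>.
\<close>

lemma gap_le_gradient:
  assumes x: "x \<in> V" and lev: "f x \<le> f x0"
  shows "gap x \<le> 2 * D * norm (g x)"
proof -
  have "norm (xstar - x) = norm ((xstar - x0) - (x - x0))" by simp
  also have "\<dots> \<le> norm (xstar - x0) + norm (x - x0)" by (rule norm_triangle_ineq4)
  also have "\<dots> \<le> 2 * D" using level[OF x lev] level[OF xstar minimizer[OF x0]] by simp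
  finally have "norm (g x) * norm (xstar - x) \<le> norm (g x) * (2 * D)" by (intro mult_left_mono) auto
  moreover have "- inner (g x) (xstar - x) \<le> norm (g x) * norm (xstar - x)"
    using norm_cauchy_schwarz[of "- g x" "xstar - x"] by simp
  ultimately show ?thesis using tangent[OF x xstar] by (simp add: mult_ac)
qed

end

section \<open>A potential that drops by one per step\<close>

text \<open>
  The arguments \<open>a\<close>, \<open>\<theta>\<close> and \<open>\<Delta>\<close> stand for the gradient norm, the ratio of the current
  regularization to its threshold, and the gap to the minimum; \<open>S = sqrt (M0 D\<^sup>3)\<close>, \<open>Q = \<delta> D\<^sup>2\<close>, and
  the linear regime of rate \<open>1 / B\<close> is only used for gaps above \<open>m\<close>.

  Halving \<open>a\<close> is worth \<open>2 ln 2 \<ge> 1\<close>.  Any other progress may come with a doubling of \<open>a\<close>, which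
  costs up to \<open>2\<close>, and must therefore be worth \<open>3\<close>: halving \<open>max 1 \<theta>\<close> or \<open>\<Delta>\<close> is, by
  \<open>6 ln 2 \<ge> 3\<close>, and so is a change of \<open>1 / 512\<close> in one of the last three terms, by \<open>1536 = 3 * 512\<close>.
\<close>

definition progress_potential :: "real \<Rightarrow> real \<Rightarrow> real \<Rightarrow> real \<Rightarrow> real \<Rightarrow> real \<Rightarrow> real \<Rightarrow> real" where
  "progress_potential B S Q m a \<theta> \<Delta> =
     2 * ln a + 6 * ln (max 1 \<theta>) + 6 * ln \<Delta>
     + 1536 * (B * ln (max \<Delta> m) - S / sqrt \<Delta> - Q / \<Delta>)"

lemma ln_halving:
  fixes u v :: real
  assumes "0 < u" "u \<le> v / 2"
  shows "ln u + 1 / 2 \<le> ln v"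
proof -
  have "ln u \<le> ln (v / 2)" using assms by (intro ln_mono) auto
  also have "\<dots> = ln v - ln 2" using assms by (simp add: ln_div)
  finally show ?thesis using ln2_ge_two_thirds by linarith
qed

lemma ln_at_most_doubling:
  fixes u v :: real
  assumes "0 < u" "u \<le> 2 * v"
  shows "ln u \<le> ln v + 1"
proof -
  have "ln u \<le> ln (2 * v)" using assms by (intro ln_mono) auto
  also have "\<dots> = ln 2 + ln v" using assms by (simp add: ln_mult)
  finally show ?thesis using ln2_le_25_over_36 by linarith
qed

text \<open>
  This lemma and the next two translate the three rates of decrease into a constant change of
  \<open>B ln \<Delta>\<close>, \<open>Q / \<Delta>\<close> and \<open>S / sqrt \<Delta>\<close>.  A step that more than halves the gap may satisfy such a
  rate without changing \<open>Q / \<Delta>\<close> or \<open>S / sqrt \<Delta>\<close> by a fixed amount, hence the assumption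
  \<open>\<Delta> \<le> 2 \<Delta>'\<close>; the term \<open>ln \<Delta>\<close> of the potential accounts for those steps.
\<close>

lemma geometric_decrease_ln:
  fixes B \<Delta> \<Delta>' c :: real
  assumes B: "0 < B" and \<Delta>': "0 < \<Delta>'" and le: "\<Delta> \<le> 2 * \<Delta>'" and le': "\<Delta>' \<le> \<Delta>"
    and dec: "c * \<Delta>' \<le> (\<Delta> - \<Delta>') * B" and c: "0 \<le> c"
  shows "c / 2 \<le> B * ln \<Delta> - B * ln \<Delta>'"
proof -
  have "ln (\<Delta>' / \<Delta>) \<le> \<Delta>' / \<Delta> - 1" using \<Delta>' le' by (intro ln_le_minus_one) auto
  then have "1 - \<Delta>' / \<Delta> \<le> ln \<Delta> - ln \<Delta>'" using \<Delta>' le' by (simp add: ln_div)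
  then have "B * (1 - \<Delta>' / \<Delta>) \<le> B * (ln \<Delta> - ln \<Delta>')" using B by (intro mult_left_mono) auto
  moreover have "c / 2 \<le> B * (1 - \<Delta>' / \<Delta>)"
  proof -
    have "c * \<Delta> \<le> 2 * (c * \<Delta>')" using mult_left_mono[OF le c] by (simp add: mult_ac)
    then have "c / 2 * \<Delta> \<le> (\<Delta> - \<Delta>') * B" using dec by linarith
    then show ?thesis using \<Delta>' le' by (simp add: field_simps)
  qed
  ultimately have "c / 2 \<le> B * (ln \<Delta> - ln \<Delta>')" by linarith
  then show ?thesis by (simp only: right_diff_distrib)
qed

lemma quadratic_decrease_inverse:
  fixes Q \<Delta> \<Delta>' c :: real
  assumes \<Delta>': "0 < \<Delta>'" and le: "\<Delta> \<le> 2 * \<Delta>'" and le': "\<Delta>' \<le> \<Delta>"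
    and dec: "c * \<Delta>'\<^sup>2 \<le> (\<Delta> - \<Delta>') * Q" and c: "0 \<le> c"
  shows "c / 2 \<le> Q / \<Delta>' - Q / \<Delta>"
proof -
  have \<Delta>: "0 < \<Delta>" using \<Delta>' le' by simp
  have "c / 2 * (\<Delta> * \<Delta>') \<le> c / 2 * (2 * \<Delta>' * \<Delta>')"
    using le \<Delta>' c by (intro mult_left_mono mult_right_mono) auto
  also have "\<dots> = c * \<Delta>'\<^sup>2" by (simp add: power2_eq_square)
  also note dec
  finally have "c / 2 \<le> (\<Delta> - \<Delta>') * Q / (\<Delta> * \<Delta>')" using \<Delta> \<Delta>' by (simp add: pos_le_divide_eq)
  also have "\<dots> = Q / \<Delta>' - Q / \<Delta>" using \<Delta> \<Delta>' by (simp add: field_simps)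
  finally show ?thesis .
qed

lemma three_halves_decrease_inverse_sqrt:
  fixes S \<Delta> \<Delta>' c :: real
  assumes \<Delta>': "0 < \<Delta>'" and le: "\<Delta> \<le> 2 * \<Delta>'" and le': "\<Delta>' \<le> \<Delta>"
    and dec: "c * (\<Delta>' * sqrt \<Delta>') \<le> (\<Delta> - \<Delta>') * S" and c: "0 \<le> c" and S: "0 \<le> S"
  shows "c / 4 \<le> S / sqrt \<Delta>' - S / sqrt \<Delta>"
proof -
  define p q where "p = sqrt \<Delta>" and "q = sqrt \<Delta>'"
  have q: "0 < q" "q \<le> p" using \<Delta>' le' by (auto simp: p_def q_def)
  have p: "0 < p" using q by simp
  have sq: "\<Delta> = p * p" "\<Delta>' = q * q" using \<Delta>' le' by (auto simp: p_def q_def)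
  have diff: "\<Delta> - \<Delta>' = (p - q) * (p + q)" unfolding sq by (simp add: algebra_simps)
  have "c * (q * q * q) \<le> (p - q) * (p + q) * S"
    using dec unfolding diff by (simp add: sq q_def[symmetric] p_def[symmetric])
       (use q in simp)
  also have "\<dots> \<le> (p - q) * (2 * p) * S"
    using q S by (intro mult_right_mono mult_left_mono) auto
  finally have 1: "c * (q * q * q) \<le> 2 * p * ((p - q) * S)" by (simp add: mult_ac)
  have "c * (p * p) * q \<le> c * (2 * (q * q)) * q"
    using le c q unfolding sq by (intro mult_right_mono mult_left_mono) auto
  then have "p * (c * p * q) \<le> p * (4 * ((p - q) * S))" using 1 by (simp add: algebra_simps)
  then have "c * p * q \<le> 4 * ((p - q) * S)" using p by (rule mult_left_le_imp_le)
  then have "c / 4 \<le> (p - q) * S / (p * q)" using p q by (simp add: pos_le_divide_eq)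
  also have "\<dots> = S / q - S / p" using p q by (simp add: field_simps)
  finally show ?thesis by (simp add: p_def q_def)
qed

text \<open>
  Every step makes progress in one of six ways: the excess regularization, the gradient norm or
  the gap halves, or the gap decreases at the linear, the \<open>3 / 2\<close>-power or the quadratic rate.
  Below \<open>m\<close> the term \<open>B ln (max \<Delta> m)\<close> has stopped moving, but there the linear rate is at least as
  fast as one of the other two, whose term moves instead.
\<close>

lemma progress_potential_drop:
  fixes B S Q m a a' \<theta> \<theta>' \<Delta> \<Delta>' :: real
  assumes B: "1 \<le> B" and S: "0 \<le> S" and Q: "0 \<le> Q" and m: "0 < m"
    and \<Delta>': "0 < \<Delta>'" and le: "\<Delta>' \<le> \<Delta>" and a': "0 < a'" "a' \<le> 2 * a"
    and \<theta>: "max 1 \<theta>' \<le> max 1 \<theta>"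
    and small: "\<Delta>' < m \<Longrightarrow> B * \<Delta>' \<le> Q \<or> B * sqrt \<Delta>' \<le> S"
    and progress: "max 1 \<theta>' \<le> max 1 \<theta> / 2 \<or> a' \<le> a / 2 \<or>
      \<Delta>' / 128 \<le> (\<Delta> - \<Delta>') * B \<or> \<Delta>' * sqrt \<Delta>' / 128 \<le> (\<Delta> - \<Delta>') * S \<or>
      \<Delta>'\<^sup>2 / 128 \<le> (\<Delta> - \<Delta>') * Q"
  shows "progress_potential B S Q m a' \<theta>' \<Delta>' + 1 \<le> progress_potential B S Q m a \<theta> \<Delta>"
proof -
  have \<Delta>: "0 < \<Delta>" using \<Delta>' le by simp
  have mono\<theta>: "ln (max 1 \<theta>') \<le> ln (max 1 \<theta>)" using \<theta> by (intro ln_mono) auto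
  have mono\<Delta>: "ln \<Delta>' \<le> ln \<Delta>" using \<Delta>' le by (intro ln_mono) auto
  have monoB: "B * ln (max \<Delta>' m) \<le> B * ln (max \<Delta> m)"
    using \<Delta>' le m B by (intro mult_left_mono ln_mono) auto
  have monoS: "S / sqrt \<Delta> \<le> S / sqrt \<Delta>'"
    using \<Delta>' le S by (intro divide_left_mono) auto
  have monoQ: "Q / \<Delta> \<le> Q / \<Delta>'" using \<Delta>' le Q by (intro divide_left_mono) auto
  have growth: "ln a' \<le> ln a + 1" using a' by (rule ln_at_most_doubling)
  note weak_monotonicity = mono\<theta> mono\<Delta> monoB monoS monoQ
  consider (startup) "max 1 \<theta>' \<le> max 1 \<theta> / 2" | (gradient) "a' \<le> a / 2" | (gap) "\<Delta>' \<le> \<Delta> / 2"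
    | (linear) "\<Delta> \<le> 2 * \<Delta>'" "m \<le> \<Delta>'" "\<Delta>' / 128 \<le> (\<Delta> - \<Delta>') * B"
    | (three_halves) "\<Delta> \<le> 2 * \<Delta>'" "\<Delta>' * sqrt \<Delta>' / 128 \<le> (\<Delta> - \<Delta>') * S"
    | (quadratic) "\<Delta> \<le> 2 * \<Delta>'" "\<Delta>'\<^sup>2 / 128 \<le> (\<Delta> - \<Delta>') * Q"
  proof -
    have "\<Delta>' * sqrt \<Delta>' / 128 \<le> (\<Delta> - \<Delta>') * S \<or> \<Delta>'\<^sup>2 / 128 \<le> (\<Delta> - \<Delta>') * Q"
      if lin: "\<Delta>' / 128 \<le> (\<Delta> - \<Delta>') * B" and "\<Delta>' < m"
      using small[OF \<open>\<Delta>' < m\<close>]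
    proof
      assume "B * \<Delta>' \<le> Q"
      then have "(\<Delta> - \<Delta>') * (B * \<Delta>') \<le> (\<Delta> - \<Delta>') * Q" using le by (intro mult_left_mono) auto
      moreover have "\<Delta>' / 128 * \<Delta>' \<le> (\<Delta> - \<Delta>') * B * \<Delta>'"
        using lin \<Delta>' by (intro mult_right_mono) auto
      moreover have "\<Delta>' / 128 * \<Delta>' = \<Delta>'\<^sup>2 / 128" by (simp add: power2_eq_square)
      moreover have "(\<Delta> - \<Delta>') * B * \<Delta>' = (\<Delta> - \<Delta>') * (B * \<Delta>')" by (rule mult.assoc)
      ultimately show ?thesis by linarith
    next
      assume "B * sqrt \<Delta>' \<le> S"
      then have "(\<Delta> - \<Delta>') * (B * sqrt \<Delta>') \<le> (\<Delta> - \<Delta>') * S" using le by (intro mult_left_mono) auto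
      moreover have "\<Delta>' / 128 * sqrt \<Delta>' \<le> (\<Delta> - \<Delta>') * B * sqrt \<Delta>'"
        using lin \<Delta>' by (intro mult_right_mono) auto
      moreover have "\<Delta>' / 128 * sqrt \<Delta>' = \<Delta>' * sqrt \<Delta>' / 128" by simp
      moreover have "(\<Delta> - \<Delta>') * B * sqrt \<Delta>' = (\<Delta> - \<Delta>') * (B * sqrt \<Delta>')" by (rule mult.assoc)
      ultimately show ?thesis by linarith
    qed
    then show ?thesis using progress that by (cases "\<Delta>' \<le> \<Delta> / 2"; cases "\<Delta>' < m") auto
  qed
  then show ?thesis
  proof cases
    case startup
    have "ln (max 1 \<theta>') + 1/2 \<le> ln (max 1 \<theta>)" using startup by (intro ln_halving) auto
    then show ?thesis using weak_monotonicity growth unfolding progress_potential_def by argo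
  next
    case gradient
    have "ln a' + 1/2 \<le> ln a" using gradient a' by (intro ln_halving) auto
    then show ?thesis using weak_monotonicity unfolding progress_potential_def by argo
  next
    case gap
    have "ln \<Delta>' + 1/2 \<le> ln \<Delta>" using gap \<Delta>' by (intro ln_halving) auto
    then show ?thesis using weak_monotonicity growth unfolding progress_potential_def by argo
  next
    case linear
    have "1/128/2 \<le> B * ln \<Delta> - B * ln \<Delta>'"
      using B \<Delta>' le linear by (intro geometric_decrease_ln) auto
    moreover have "B * ln (max \<Delta>' m) = B * ln \<Delta>'" "B * ln (max \<Delta> m) = B * ln \<Delta>"
      using linear le by (simp_all add: max_absorb1)
    ultimately show ?thesis using weak_monotonicity growth unfolding progress_potential_def by argo
  next
    case three_halves
    have "1/128/4 \<le> S / sqrt \<Delta>' - S / sqrt \<Delta>"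
      using S \<Delta>' le three_halves by (intro three_halves_decrease_inverse_sqrt) auto
    then show ?thesis using weak_monotonicity growth unfolding progress_potential_def by argo
  next
    case quadratic
    have "1/128/2 \<le> Q / \<Delta>' - Q / \<Delta>"
      using \<Delta>' le quadratic by (intro quadratic_decrease_inverse) auto
    then show ?thesis using weak_monotonicity growth unfolding progress_potential_def by argo
  qed
qed

context newton_problem
begin

lemma eps_tr_split:
  "eps_tr D B M0 \<delta> = M0 * D ^ 3 / B\<^sup>2 \<or> eps_tr D B M0 \<delta> = \<delta> * D\<^sup>2 / B"
  by (auto simp: eps_tr_def max_def)

text \<open>
  The transition gap is where the linear rate \<open>1 / B\<close> meets the slower of the other two rates.
\<close>

lemma small_gap_regime:
  assumes e: "0 < e" and small: "e < eps_tr D B M0 \<delta>"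
  shows "B * e \<le> \<delta> * D\<^sup>2 \<or> B * sqrt e \<le> sqrt (M0 * D ^ 3)"
  using eps_tr_split
proof
  assume "eps_tr D B M0 \<delta> = \<delta> * D\<^sup>2 / B"
  then have "e < \<delta> * D\<^sup>2 / B" using small by simp
  then show ?thesis using B by (simp add: field_simps)
next
  assume "eps_tr D B M0 \<delta> = M0 * D ^ 3 / B\<^sup>2"
  then have "e < M0 * D ^ 3 / B\<^sup>2" using small by simp
  then have "B\<^sup>2 * e \<le> M0 * D ^ 3" using B by (simp add: field_simps)
  then have "sqrt (B\<^sup>2 * e) \<le> sqrt (M0 * D ^ 3)" by (rule real_sqrt_le_mono)
  then show ?thesis using B by (simp add: real_sqrt_mult)
qed

text \<open>
  The entry that attains the maximum in the threshold decides the regime.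
\<close>

lemma descent_regimes:
  assumes e: "0 < e" "e \<le> 2 * D * a" and drop: "a\<^sup>2 \<le> 8 * threshold a * \<Delta>"
  shows "e / 128 \<le> \<Delta> * B \<or> e * sqrt e / 128 \<le> \<Delta> * sqrt (M0 * D ^ 3) \<or>
    e\<^sup>2 / 128 \<le> \<Delta> * (\<delta> * D\<^sup>2)"
proof -
  have a: "0 < a"
    using e D by (smt (verit) mult_nonneg_nonpos)
  have \<Delta>: "0 \<le> \<Delta>"
  proof -
    have "0 \<le> 8 * threshold a * \<Delta>" using drop zero_le_power2[of a] by linarith
    then show ?thesis using threshold_pos[OF a] by (simp add: zero_le_mult_iff)
  qed
  have "threshold a = 4 * \<delta> \<or> threshold a = B * a / D \<or> threshold a = sqrt (8 * M0 * a)"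
    by (simp add: threshold_def max_def)
  then consider "threshold a = 4 * \<delta>" | "threshold a = B * a / D" | "threshold a = sqrt (8 * M0 * a)"
    by blast
  then show ?thesis
  proof cases
    case 1
    have "e\<^sup>2 \<le> (2 * D * a)\<^sup>2" using e by (intro power_mono) auto
    also have "\<dots> = 4 * D\<^sup>2 * a\<^sup>2" by (simp add: power_mult_distrib)
    also have "\<dots> \<le> 4 * D\<^sup>2 * (8 * threshold a * \<Delta>)" using drop by (intro mult_left_mono) auto
    finally show ?thesis by (simp add: 1 mult_ac)
  next
    case 2
    have "a * a \<le> a * (8 * (B / D) * \<Delta>)" using drop by (simp add: 2 power2_eq_square mult_ac)
    then have "a \<le> 8 * (B / D) * \<Delta>" using a by (rule mult_left_le_imp_le)
    then have "2 * D * a \<le> 2 * D * (8 * (B / D) * \<Delta>)" using D by (intro mult_left_mono) auto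
    also have "\<dots> = 16 * (\<Delta> * B)" using D by simp
    finally have "e \<le> 16 * (\<Delta> * B)" using e by linarith
    then show ?thesis using \<Delta> B e by simp
  next
    case 3
    define p where "p = sqrt a"
    have p: "0 < p" "a = p * p" using a by (auto simp: p_def)
    have D3: "sqrt (M0 * D ^ 3) = sqrt M0 * (D * sqrt D)"
      using D by (simp add: real_sqrt_mult power3_eq_cube)
    have "p * (p * p * p) \<le> p * (8 * (sqrt 8 * sqrt M0) * \<Delta>)"
    proof -
      have "sqrt (8 * M0 * a) = sqrt 8 * sqrt M0 * p" by (simp add: real_sqrt_mult p_def)
      then have "a\<^sup>2 \<le> 8 * (sqrt 8 * sqrt M0 * p) * \<Delta>" using drop by (simp only: 3)
      then show ?thesis by (simp add: p(2) power2_eq_square mult_ac)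
    qed
    then have "p * p * p \<le> 8 * (sqrt 8 * sqrt M0) * \<Delta>" using p(1) by (rule mult_left_le_imp_le)
    then have ap: "a * p \<le> 8 * (sqrt 8 * sqrt M0) * \<Delta>" by (simp add: p(2))
    have "e * sqrt e \<le> (2 * D * a) * sqrt (2 * D * a)"
      using e by (intro mult_mono) auto
    also have "\<dots> = 2 * sqrt 2 * (D * sqrt D) * (a * p)"
      by (simp add: real_sqrt_mult p_def)
    also have "\<dots> \<le> 2 * sqrt 2 * (D * sqrt D) * (8 * (sqrt 8 * sqrt M0) * \<Delta>)"
      using ap D by (intro mult_left_mono) auto
    also have "\<dots> = 16 * (sqrt 2 * sqrt 8) * (\<Delta> * (sqrt M0 * (D * sqrt D)))" by (simp add: mult_ac)
    also have "sqrt 2 * sqrt 8 = (4::real)"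
      by (simp add: real_sqrt_mult[symmetric])
    finally have "e * sqrt e \<le> 64 * (\<Delta> * sqrt (M0 * D ^ 3))" by (simp add: D3)
    moreover have "0 \<le> \<Delta> * sqrt (M0 * D ^ 3)" using \<Delta> D M0 by simp
    ultimately show ?thesis by linarith
  qed
qed

definition potential :: "real \<Rightarrow> fin_seq \<Rightarrow> real \<Rightarrow> real" where
  "potential \<epsilon> x \<eta> = progress_potential B (sqrt (M0 * D ^ 3)) (\<delta> * D\<^sup>2)
     (max \<epsilon> (eps_tr D B M0 \<delta>)) (norm (g x)) (\<eta> / threshold (norm (g x))) (gap x)"

text \<open>
  If \<open>\<tau>\<close> exceeds twice the threshold, no trial was rejected, so \<open>\<tau> = \<eta>\<close>, and the halving in the
  update of \<open>\<eta>\<close> is the progress.  Otherwise either the gradient norm halves, or it is comparable to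
  the previous one; then \<open>\<tau>\<close> is at most four times the threshold at the new point, and the decrease
  \<open>a'\<^sup>2 / (2 \<tau>)\<close> puts the gap into one of the three regimes.
\<close>

lemma method_step:
  assumes x: "x \<in> V" and lev: "f x \<le> f x0" and \<eta>: "0 < \<eta>" and \<epsilon>: "0 < \<epsilon>"
    and step: "ms_backtrack V g H x \<eta> x' \<tau>"
    and \<eta>'_def: "\<eta>' = \<tau> / 2 * min 1 (norm (g x') / norm (g x))"
    and gap': "\<epsilon> < gap x'"
  shows "x' \<in> V" and "f x' \<le> f x0" and "0 < \<eta>'"
    and "potential \<epsilon> x' \<eta>' + 1 \<le> potential \<epsilon> x \<eta>"
proof -
  let ?a = "norm (g x)" and ?a' = "norm (g x')"
  obtain s where s: "x' = x + s" "ms_accepts V g H x \<tau> s" and \<tau>: "\<eta> \<le> \<tau>" "\<tau> \<le> max \<eta> (2 * threshold ?a)"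
    using backtrack_result[OF step x \<eta>] by blast
  have \<tau>0: "0 < \<tau>" using \<tau> \<eta> by simp
  show x': "x' \<in> V" using x s subspace_Rn by (auto simp: ms_accepts_def subspace_add)
  have drop: "?a'\<^sup>2 / (2 * \<tau>) \<le> f x - f x'" and growth: "?a' \<le> 2 * ?a"
    using accepted_step[OF x \<tau>0 s(2)] s(1) by auto
  have "0 \<le> ?a'\<^sup>2 / (2 * \<tau>)" using \<tau>0 by simp
  then have le: "f x' \<le> f x" using drop by linarith
  then show lev': "f x' \<le> f x0" using lev by simp
  have gapa': "gap x' \<le> 2 * D * ?a'" by (rule gap_le_gradient[OF x' lev'])
  have "0 < 2 * D * ?a'" using gapa' gap' \<epsilon> by linarith
  then have a': "0 < ?a'" using D by (simp add: zero_less_mult_iff)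
  then have a: "0 < ?a" using growth by linarith
  show \<eta>'0: "0 < \<eta>'" using \<tau>0 a a' by (simp add: \<eta>'_def)
  have Ta: "0 < threshold ?a" and Ta': "0 < threshold ?a'" using a a' threshold_pos by auto
  have scaled: "\<eta>' / threshold ?a' \<le> \<tau> / 2 / threshold ?a"
  proof -
    have "threshold ?a * min 1 (?a' / ?a) \<le> threshold ?a'"
    proof (cases "?a \<le> ?a'")
      case True
      then show ?thesis using threshold_mono[of ?a ?a'] a by (simp add: min_def)
    next
      case False
      then have "threshold ?a * ?a' \<le> threshold ?a' * ?a" using a' by (intro threshold_ratio) auto
      then show ?thesis using False a by (simp add: min_def field_simps)
    qed
    then have "\<tau> / 2 * (threshold ?a * min 1 (?a' / ?a)) \<le> \<tau> / 2 * threshold ?a'"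
      using \<tau>0 by (intro mult_left_mono) auto
    then show ?thesis using Ta Ta' by (simp add: \<eta>'_def field_simps)
  qed
  have \<theta>: "max 1 (\<eta>' / threshold ?a') \<le> max 1 (\<eta> / threshold ?a)"
  proof -
    have "\<tau> / 2 / threshold ?a \<le> max \<eta> (2 * threshold ?a) / 2 / threshold ?a"
      using \<tau> Ta by (intro divide_right_mono) auto
    also have "\<dots> \<le> max 1 (\<eta> / threshold ?a)"
      using Ta \<eta> by (auto simp: max_def field_simps)
    finally show ?thesis using scaled by simp
  qed
  have progress: "max 1 (\<eta>' / threshold ?a') \<le> max 1 (\<eta> / threshold ?a) / 2 \<or> ?a' \<le> ?a / 2 \<or>
      gap x' / 128 \<le> (gap x - gap x') * B \<or>
      gap x' * sqrt (gap x') / 128 \<le> (gap x - gap x') * sqrt (M0 * D ^ 3) \<or>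
      (gap x')\<^sup>2 / 128 \<le> (gap x - gap x') * (\<delta> * D\<^sup>2)"
  proof (cases "2 * threshold ?a < \<tau>")
    case True
    then have eq: "\<tau> = \<eta>" using \<tau> by auto
    have "2 \<le> \<eta> / threshold ?a" using True Ta by (simp add: eq field_simps)
    then show ?thesis using scaled by (simp add: eq)
  next
    case False
    show ?thesis
    proof (cases "?a' \<le> ?a / 2")
      case False
      have "threshold ?a \<le> threshold (2 * ?a')" using False by (intro threshold_mono) auto
      also have "\<dots> \<le> 2 * threshold ?a'" using threshold_ratio[of ?a' "2 * ?a'"] a' by simp
      finally have "\<tau> \<le> 4 * threshold ?a'" using \<open>\<not> 2 * threshold ?a < \<tau>\<close> by simp
      moreover have "?a'\<^sup>2 \<le> 2 * \<tau> * (gap x - gap x')" using drop \<tau>0 by (simp add: field_simps)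
      moreover have "0 \<le> gap x - gap x'" using le by simp
      ultimately have "?a'\<^sup>2 \<le> 8 * threshold ?a' * (gap x - gap x')"
        using mult_right_mono[of "2 * \<tau>" "8 * threshold ?a'" "gap x - gap x'"] by linarith
      then show ?thesis using descent_regimes[of "gap x'" ?a'] gapa' gap' \<epsilon> by simp
    qed simp
  qed
  show "potential \<epsilon> x' \<eta>' + 1 \<le> potential \<epsilon> x \<eta>"
    unfolding potential_def
  proof (rule progress_potential_drop[OF B _ _ _ _ _ a' growth \<theta> _ progress])
    assume "gap x' < max \<epsilon> (eps_tr D B M0 \<delta>)"
    then show "B * gap x' \<le> \<delta> * D\<^sup>2 \<or> B * sqrt (gap x') \<le> sqrt (M0 * D ^ 3)"
      using gap' \<epsilon> by (intro small_gap_regime) auto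
  qed (use M0 D delta_nonneg \<epsilon> gap' le in auto)
qed

text \<open>
  A positive gap excludes a zero gradient, so the method cannot stop early without having reached
  the accuracy \<open>\<epsilon>\<close>.
\<close>

lemma iterates_or_done:
  assumes \<eta>0: "0 < \<eta>0" and \<epsilon>: "0 < \<epsilon>" and start: "\<epsilon> < gap x0"
  shows "(\<exists>k x \<eta>. k \<le> n \<and> arn_iterate V g H x0 \<eta>0 k x \<eta> \<and> gap x \<le> \<epsilon>) \<or>
    (\<exists>x \<eta>. arn_iterate V g H x0 \<eta>0 n x \<eta> \<and> x \<in> V \<and> f x \<le> f x0 \<and> 0 < \<eta> \<and> \<epsilon> < gap x \<and>
      potential \<epsilon> x \<eta> + real n \<le> potential \<epsilon> x0 \<eta>0)"
proof (induction n)
  case 0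
  show ?case
    by (intro disjI2 exI[of _ x0] exI[of _ \<eta>0]) (simp add: arn_iterate.start x0 \<eta>0 start)
next
  case (Suc n)
  then show ?case
  proof
    assume "\<exists>k x \<eta>. k \<le> n \<and> arn_iterate V g H x0 \<eta>0 k x \<eta> \<and> gap x \<le> \<epsilon>"
    then show ?thesis using le_SucI by blast
  next
    assume "\<exists>x \<eta>. arn_iterate V g H x0 \<eta>0 n x \<eta> \<and> x \<in> V \<and> f x \<le> f x0 \<and> 0 < \<eta> \<and> \<epsilon> < gap x \<and>
      potential \<epsilon> x \<eta> + real n \<le> potential \<epsilon> x0 \<eta>0"
    then obtain x \<eta> where x: "arn_iterate V g H x0 \<eta>0 n x \<eta>" "x \<in> V" "f x \<le> f x0" "0 < \<eta>"
      "\<epsilon> < gap x" "potential \<epsilon> x \<eta> + real n \<le> potential \<epsilon> x0 \<eta>0" by blast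
    have "g x \<noteq> 0" using gap_le_gradient[OF x(2,3)] x(5) \<epsilon> by auto
    obtain x' \<tau> where step: "ms_backtrack V g H x \<eta> x' \<tau>"
      using backtrack_terminates[OF x(2,4)] by blast
    define \<eta>' where "\<eta>' = \<tau> / 2 * min 1 (norm (g x') / norm (g x))"
    have it: "arn_iterate V g H x0 \<eta>0 (Suc n) x' \<eta>'"
      unfolding \<eta>'_def by (rule arn_iterate.step[OF x(1) \<open>g x \<noteq> 0\<close> step])
    show ?thesis
    proof (cases "gap x' \<le> \<epsilon>")
      case True
      then show ?thesis using it by blast
    next
      case False
      then have "\<epsilon> < gap x'" by simp
      note * = method_step[OF x(2-4) \<epsilon> step \<eta>'_def this]
      have "potential \<epsilon> x' \<eta>' + real (Suc n) \<le> potential \<epsilon> x0 \<eta>0" using *(4) x(6) by simp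
      then show ?thesis using it * \<open>\<epsilon> < gap x'\<close> by blast
    qed
  qed
qed

lemma potential_difference:
  assumes \<epsilon>: "0 < \<epsilon>" and start: "\<epsilon> < gap x0"
    and x: "x \<in> V" "f x \<le> f x0" "\<epsilon> < gap x"
  shows "potential \<epsilon> x0 \<eta>0 - potential \<epsilon> x \<eta> \<le>
    8 * ln (2 * D * norm (g x0) / \<epsilon>) + 6 * ln (max 1 (\<eta>0 / threshold (norm (g x0))))
    + 1536 * (B * log_plus (gap x0 / max \<epsilon> (eps_tr D B M0 \<delta>)) + sqrt (M0 * D ^ 3 / \<epsilon>) + \<delta> * D\<^sup>2 / \<epsilon>)"
proof -
  let ?m = "max \<epsilon> (eps_tr D B M0 \<delta>)" and ?S = "sqrt (M0 * D ^ 3)" and ?Q = "\<delta> * D\<^sup>2"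
  let ?b = "norm (g x0)" and ?a = "norm (g x)"
  have m: "0 < ?m" using \<epsilon> by simp
  have gap0: "gap x0 \<le> 2 * D * ?b" by (rule gap_le_gradient[OF x0 order.refl])
  have gapx: "gap x \<le> 2 * D * ?a" by (rule gap_le_gradient[OF x(1,2)])
  have "0 < 2 * D * ?b" using gap0 start \<epsilon> by linarith
  then have a0: "0 < ?b" using D by (simp add: zero_less_mult_iff)
  have "0 < 2 * D * ?a" using gapx x(3) \<epsilon> by linarith
  then have a: "0 < ?a" using D by (simp add: zero_less_mult_iff)
  have "ln ?b - ln ?a = ln (2 * D * ?b) - ln (2 * D * ?a)" using D a0 a by (simp add: ln_mult)
  also have "\<dots> \<le> ln (2 * D * ?b) - ln \<epsilon>" using gapx x(3) \<epsilon> by (intro diff_left_mono ln_mono) auto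
  finally have 1: "ln ?b - ln ?a \<le> ln (2 * D * ?b / \<epsilon>)" using D a0 \<epsilon> by (simp add: ln_div)
  have "ln (gap x0) - ln (gap x) \<le> ln (2 * D * ?b) - ln \<epsilon>"
    using gap0 start x(3) \<epsilon> by (intro diff_mono ln_mono) auto
  then have 2: "ln (gap x0) - ln (gap x) \<le> ln (2 * D * ?b / \<epsilon>)" using D a0 \<epsilon> by (simp add: ln_div)
  have "ln (max (gap x0) ?m) - ln (max (gap x) ?m) \<le> ln (max (gap x0) ?m) - ln ?m"
    using m by (intro diff_left_mono ln_mono) auto
  also have "\<dots> = ln (max (gap x0) ?m / ?m)"
    using m ln_divide_pos[of "max (gap x0) ?m" ?m] by linarith
  also have "max (gap x0) ?m / ?m = max (gap x0 / ?m) 1" using m by (simp add: max_def field_simps)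
  also have "ln (max (gap x0 / ?m) 1) \<le> log_plus (gap x0 / ?m)"
    by (auto simp: log_plus_def max_def)
  finally have "B * (ln (max (gap x0) ?m) - ln (max (gap x) ?m)) \<le> B * log_plus (gap x0 / ?m)"
    using B by (intro mult_left_mono) auto
  then have 3: "B * ln (max (gap x0) ?m) - B * ln (max (gap x) ?m) \<le> B * log_plus (gap x0 / ?m)"
    by (simp add: right_diff_distrib)
  have S: "0 \<le> ?S" and Q: "0 \<le> ?Q" using M0 D delta_nonneg by auto
  have "?S / sqrt (gap x) \<le> ?S / sqrt \<epsilon>" using S \<epsilon> x(3) by (intro divide_left_mono) auto
  moreover have "0 \<le> ?S / sqrt (gap x0)" using S start \<epsilon> by simp
  ultimately have 4: "?S / sqrt (gap x) - ?S / sqrt (gap x0) \<le> sqrt (M0 * D ^ 3 / \<epsilon>)"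
    by (simp add: real_sqrt_divide)
  have "?Q / gap x \<le> ?Q / \<epsilon>" using Q \<epsilon> x(3) by (intro divide_left_mono) auto
  moreover have "0 \<le> ?Q / gap x0" using Q start \<epsilon> by simp
  ultimately have 5: "?Q / gap x - ?Q / gap x0 \<le> ?Q / \<epsilon>" by linarith
  have 6: "0 \<le> ln (max 1 (\<eta> / threshold ?a))" by simp
  show ?thesis
    unfolding potential_def progress_potential_def using 1 2 3 4 5 6 by argo
qed

section \<open>The iteration count\<close>

lemma iteration_bound:
  assumes \<eta>0: "0 < \<eta>0" and \<epsilon>: "0 < \<epsilon>" and start: "\<epsilon> < gap x0"
  shows "\<exists>N x \<eta>. arn_iterate V g H x0 \<eta>0 N x \<eta> \<and> gap x \<le> \<epsilon> \<and> real N \<le> 1 +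
    (8 * ln (2 * D * norm (g x0) / \<epsilon>) + 6 * ln (max 1 (\<eta>0 / threshold (norm (g x0))))
    + 1536 * (B * log_plus (gap x0 / max \<epsilon> (eps_tr D B M0 \<delta>)) + sqrt (M0 * D ^ 3 / \<epsilon>) + \<delta> * D\<^sup>2 / \<epsilon>))"
    (is "\<exists>N x \<eta>. _ \<and> _ \<and> real N \<le> 1 + ?R")
proof -
  have R: "0 \<le> ?R" using potential_difference[OF \<epsilon> start x0 order.refl start, of \<eta>0 \<eta>0] by simp
  define n where "n = Suc (nat \<lfloor>?R\<rfloor>)"
  have n: "?R < real n" "real n \<le> 1 + ?R" using R unfolding n_def by linarith+
  from iterates_or_done[OF \<eta>0 \<epsilon> start, of n] show ?thesis
  proof
    assume "\<exists>k x \<eta>. k \<le> n \<and> arn_iterate V g H x0 \<eta>0 k x \<eta> \<and> gap x \<le> \<epsilon>"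
    then obtain k x \<eta> where k: "k \<le> n" "arn_iterate V g H x0 \<eta>0 k x \<eta>" "gap x \<le> \<epsilon>" by blast
    then have "real k \<le> 1 + ?R" using n(2) by linarith
    then show ?thesis using k by blast
  next
    assume "\<exists>x \<eta>. arn_iterate V g H x0 \<eta>0 n x \<eta> \<and> x \<in> V \<and> f x \<le> f x0 \<and> 0 < \<eta> \<and> \<epsilon> < gap x \<and>
      potential \<epsilon> x \<eta> + real n \<le> potential \<epsilon> x0 \<eta>0"
    then obtain x \<eta> where x: "x \<in> V" "f x \<le> f x0" "\<epsilon> < gap x"
      "potential \<epsilon> x \<eta> + real n \<le> potential \<epsilon> x0 \<eta>0" by blast
    then show ?thesis using potential_difference[OF \<epsilon> start x(1-3), of \<eta>0 \<eta>] n(1) by linarith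
  qed
qed

text \<open>
  The left-hand sides are governed by the accuracy \<open>\<epsilon>\<close>, while \<open>l\<close> contains the transition gap \<open>e\<close>.
  Since \<open>e / \<epsilon>\<close> is at most \<open>M0 D\<^sup>3 / \<epsilon>\<close> or \<open>\<delta> D\<^sup>2 / \<epsilon>\<close>, its logarithm is dominated by the
  polynomial terms \<open>Z\<close>.  For the initial regularization, \<open>e = \<delta> D\<^sup>2 / B\<close> allows comparing the
  threshold with its entry \<open>4 \<delta>\<close>; in the other case the gradient norm is at least \<open>\<epsilon> / (2 D)\<close>, which
  bounds the entry involving \<open>M0\<close> from below.
\<close>

lemma startup_logs:
  fixes \<epsilon> \<eta>0 :: real
  defines "e \<equiv> eps_tr D B M0 \<delta>"
  defines "l \<equiv> max 1 (max (2 * D * norm (g x0) / e) (\<eta>0 * D\<^sup>2 / (sqrt 6 * B * e)))"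
  defines "Z \<equiv> sqrt (M0 * D ^ 3 / \<epsilon>) + \<delta> * D\<^sup>2 / \<epsilon>"
  assumes \<eta>0: "0 < \<eta>0" and \<epsilon>: "0 < \<epsilon>" and start: "\<epsilon> < gap x0" and e: "0 < e"
  shows "ln (2 * D * norm (g x0) / \<epsilon>) \<le> ln l + 2 * Z"
    and "ln (max 1 (\<eta>0 / threshold (norm (g x0)))) \<le> ln l + 3 * Z"
proof -
  let ?b = "norm (g x0)" and ?z = "sqrt (M0 * D ^ 3 / \<epsilon>)"
  have gap0: "gap x0 \<le> 2 * D * ?b" by (rule gap_le_gradient[OF x0 order.refl])
  have "0 < 2 * D * ?b" using gap0 start \<epsilon> by linarith
  then have b: "0 < ?b" using D by (simp add: zero_less_mult_iff)
  have z: "0 \<le> ?z" using M0 D \<epsilon> by simp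
  have q: "0 \<le> \<delta> * D\<^sup>2 / \<epsilon>" using delta_nonneg \<epsilon> by simp
  have Z: "?z \<le> Z" "\<delta> * D\<^sup>2 / \<epsilon> \<le> Z" "0 \<le> Z" using z q by (auto simp: Z_def)
  have l1: "1 \<le> l" by (simp add: l_def)
  have "ln (e / \<epsilon>) \<le> 2 * Z"
    using eps_tr_split
  proof
    assume eq: "eps_tr D B M0 \<delta> = \<delta> * D\<^sup>2 / B"
    have "ln (e / \<epsilon>) \<le> e / \<epsilon>" using e \<epsilon> by (intro ln_bound) auto
    also have "\<dots> \<le> \<delta> * D\<^sup>2 / \<epsilon>"
    proof (rule divide_right_mono)
      have "\<delta> * D\<^sup>2 * 1 \<le> \<delta> * D\<^sup>2 * B" using B delta_nonneg by (intro mult_left_mono) auto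
      then show "e \<le> \<delta> * D\<^sup>2" unfolding e_def eq using B by (simp add: pos_divide_le_eq)
    qed (use \<epsilon> in simp)
    finally have "ln (e / \<epsilon>) \<le> Z" using Z(2) by (rule order_trans)
    then show ?thesis using Z(3) by linarith
  next
    assume eq: "eps_tr D B M0 \<delta> = M0 * D ^ 3 / B\<^sup>2"
    have "e \<le> M0 * D ^ 3"
    proof -
      have "M0 * D ^ 3 * 1 \<le> M0 * D ^ 3 * B\<^sup>2" using B D M0 by (intro mult_left_mono) auto
      then show ?thesis unfolding e_def eq using B by (simp add: pos_divide_le_eq)
    qed
    then have "e / \<epsilon> \<le> ?z * ?z" using M0 D \<epsilon> by (simp add: divide_right_mono)
    moreover have z0: "0 < ?z" using \<open>e \<le> M0 * D ^ 3\<close> e \<epsilon> by simp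
    ultimately have "ln (e / \<epsilon>) \<le> ln (?z * ?z)" using e \<epsilon> by (intro ln_mono) auto
    also have "\<dots> = 2 * ln ?z" using z0 by (simp only: ln_mult_pos)
    also have "\<dots> \<le> 2 * ?z" using ln_bound[OF z0] by simp
    finally show ?thesis using Z(1) by linarith
  qed
  moreover have "ln (2 * D * ?b / \<epsilon>) = ln (2 * D * ?b / e) + ln (e / \<epsilon>)"
    using D b e \<epsilon> by (simp add: ln_div)
  moreover have "ln (2 * D * ?b / e) \<le> ln l"
    using D b e by (intro ln_mono) (auto simp: l_def)
  ultimately show "ln (2 * D * ?b / \<epsilon>) \<le> ln l + 2 * Z" by linarith
  have T: "0 < threshold ?b" using b by (rule threshold_pos)
  have "\<eta>0 / threshold ?b \<le> l * max 1 (3 * ?z)"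
    using eps_tr_split
  proof
    assume eq: "eps_tr D B M0 \<delta> = \<delta> * D\<^sup>2 / B"
    have \<delta>: "0 < \<delta>" using e B D unfolding e_def eq by (simp add: zero_less_divide_iff zero_less_mult_iff)
    have "sqrt 6 \<le> sqrt 16" by (rule real_sqrt_le_mono) simp
    then have s: "sqrt 6 * \<delta> \<le> 4 * \<delta>" using \<delta> by simp
    have "\<eta>0 / threshold ?b \<le> \<eta>0 / (sqrt 6 * \<delta>)"
      using order_trans[OF s threshold_bounds(1)[of ?b]] \<eta>0 \<delta> T
      by (intro divide_left_mono) (auto simp del: mult_le_cancel_right)
    also have "\<dots> = \<eta>0 * D\<^sup>2 / (sqrt 6 * B * e)"
      unfolding e_def eq using B D \<delta> by simp
    also have "\<dots> \<le> l" by (simp add: l_def)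
    also have "\<dots> \<le> l * max 1 (3 * ?z)" using l1 mult_left_mono[of 1 "max 1 (3 * ?z)" l] by simp
    finally show ?thesis .
  next
    assume eq: "eps_tr D B M0 \<delta> = M0 * D ^ 3 / B\<^sup>2"
    have M0': "0 < M0" using e B D unfolding e_def eq by (simp add: zero_less_divide_iff zero_less_mult_iff)
    have "\<epsilon> / D \<le> 2 * ?b" using gap0 start D by (simp add: field_simps)
    then have "M0 * (\<epsilon> / D) \<le> M0 * (2 * ?b)" using M0' by (intro mult_left_mono) auto
    also have "\<dots> \<le> 8 * M0 * ?b" using M0' b by simp
    finally have "sqrt (M0 * (\<epsilon> / D)) \<le> sqrt (8 * M0 * ?b)" by (rule real_sqrt_le_mono)
    also have "\<dots> \<le> threshold ?b" by (rule threshold_bounds)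
    finally have Tl: "sqrt (M0 * (\<epsilon> / D)) \<le> threshold ?b" .
    have "sqrt (M0 * (\<epsilon> / D)) * ?z = sqrt ((M0 * D)\<^sup>2)"
      unfolding real_sqrt_mult[symmetric]
      using D \<epsilon> by (intro arg_cong[of _ _ sqrt]) (simp add: power2_eq_square power3_eq_cube)
    also have "\<dots> = M0 * D" using M0' D by simp
    finally have "M0 * D \<le> threshold ?b * ?z" using Tl z by (metis mult_right_mono)
    also have eB: "M0 * D = e * B\<^sup>2 / D\<^sup>2"
      unfolding e_def eq using B D by (simp add: power2_eq_square power3_eq_cube)
    finally have "e * B\<^sup>2 \<le> threshold ?b * ?z * D\<^sup>2" using D by (simp add: pos_divide_le_eq)
    moreover have "e * B \<le> e * B\<^sup>2" using e B by (simp add: power2_eq_square)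
    ultimately have "e * B \<le> threshold ?b * ?z * D\<^sup>2" by linarith
    then have "\<eta>0 * (e * B) \<le> \<eta>0 * (threshold ?b * ?z * D\<^sup>2)" using \<eta>0 by (intro mult_left_mono) auto
    then have "\<eta>0 / threshold ?b \<le> \<eta>0 * D\<^sup>2 / (B * e) * ?z"
      using T e B by (simp add: field_simps)
    also have "\<dots> = \<eta>0 * D\<^sup>2 / (sqrt 6 * B * e) * (sqrt 6 * ?z)" by simp
    also have "\<dots> \<le> l * (sqrt 6 * ?z)" using z by (intro mult_right_mono) (auto simp: l_def)
    also have "\<dots> \<le> l * max 1 (3 * ?z)"
    proof (rule mult_left_mono)
      have "sqrt 6 * ?z \<le> 3 * ?z" using z by (intro mult_right_mono real_le_lsqrt) auto
      then show "sqrt 6 * ?z \<le> max 1 (3 * ?z)" by simp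
    qed (use l1 in simp)
    finally show ?thesis .
  qed
  moreover have "1 \<le> l * max 1 (3 * ?z)"
    using l1 mult_mono[of 1 l 1 "max 1 (3 * ?z)"] by simp
  ultimately have "ln (max 1 (\<eta>0 / threshold ?b)) \<le> ln (l * max 1 (3 * ?z))"
    by (intro ln_mono) auto
  also have "\<dots> = ln l + ln (max 1 (3 * ?z))" using l1 by (intro ln_mult_pos) auto
  also have "ln (max 1 (3 * ?z)) \<le> 3 * ?z"
  proof (cases "3 * ?z \<le> 1")
    case True
    then show ?thesis using z by (simp add: max_absorb1)
  next
    case False
    then show ?thesis using ln_bound[of "3 * ?z"] by (simp only: max_absorb2)
  qed
  finally show "ln (max 1 (\<eta>0 / threshold ?b)) \<le> ln l + 3 * Z" using Z(1) by linarith
qed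

end

lemma log_ereal_nonneg: "1 \<le> t \<Longrightarrow> 0 \<le> log_ereal t"
  by (cases t) (auto simp: log_ereal_def)

lemma one_le_ell0: "1 \<le> ell0 D B \<epsilon>tr gn \<eta>0"
  by (simp add: ell0_def)

lemma ell0_finite:
  assumes "\<epsilon>tr > 0" "B > 0"
  shows "ell0 D B \<epsilon>tr gn \<eta>0 =
    ereal (max 1 (max (2 * D * gn / \<epsilon>tr) (\<eta>0 * D\<^sup>2 / (sqrt 6 * B * \<epsilon>tr))))"
  using assms by (simp add: ell0_def one_ereal_def del: ereal_max) (simp add: ereal_max)

lemma ell0_infinite: "0 < D \<Longrightarrow> 0 < gn \<Longrightarrow> ell0 D B 0 gn \<eta>0 = \<infinity>"
  by (simp add: ell0_def divide_ereal_def max_def)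

lemma log_plus_nonneg: "0 \<le> log_plus t"
  by (simp add: log_plus_def)

text \<open>
  If the transition gap vanishes, the bound is infinite and the assertion is that the method
  reaches accuracy \<open>\<epsilon>\<close> at all.  Otherwise \<open>startup_logs\<close> bounds the two logarithms, which leaves
  \<open>14 ln l\<close> and the coefficient \<open>8 * 2 + 6 * 3 + 1536 = 1570\<close> on the polynomial terms.
\<close>

lemma (in newton_problem) complexity:
  assumes \<eta>0: "0 < \<eta>0" and \<epsilon>: "0 < \<epsilon>" and start: "\<epsilon> < gap x0"
  shows "\<exists>N x \<eta>. arn_iterate V g H x0 \<eta>0 N x \<eta> \<and> gap x \<le> \<epsilon> \<and>
    ereal (real N) \<le> ereal 2000 *
      (1 + log_ereal (ell0 D B (eps_tr D B M0 \<delta>) (norm (g x0)) \<eta>0) +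
       ereal (B * log_plus (gap x0 / max \<epsilon> (eps_tr D B M0 \<delta>))
              + sqrt (M0 * D ^ 3 / \<epsilon>) + \<delta> * D\<^sup>2 / \<epsilon>))"
proof -
  let ?e = "eps_tr D B M0 \<delta>"
  let ?P = "B * log_plus (gap x0 / max \<epsilon> ?e)" and ?z = "sqrt (M0 * D ^ 3 / \<epsilon>)" and ?q = "\<delta> * D\<^sup>2 / \<epsilon>"
  obtain N x \<eta> where N: "arn_iterate V g H x0 \<eta>0 N x \<eta>" "gap x \<le> \<epsilon>" and count: "real N \<le> 1 +
    (8 * ln (2 * D * norm (g x0) / \<epsilon>) + 6 * ln (max 1 (\<eta>0 / threshold (norm (g x0))))
    + 1536 * (?P + ?z + ?q))"
    using iteration_bound[OF \<eta>0 \<epsilon> start] by blast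
  have z: "0 \<le> ?z" and q: "0 \<le> ?q" and P: "0 \<le> ?P"
    using M0 D \<epsilon> delta_nonneg B log_plus_nonneg by auto
  have e0: "0 \<le> ?e" using M0 D by (simp add: eps_tr_def le_max_iff_disj)
  have "ereal (real N) \<le> ereal 2000 * (1 + log_ereal (ell0 D B ?e (norm (g x0)) \<eta>0) + ereal (?P + ?z + ?q))"
  proof (cases "?e = 0")
    case True
    have "0 < 2 * D * norm (g x0)"
      using gap_le_gradient[OF x0 order.refl] start \<epsilon> by linarith
    then have "0 < norm (g x0)" using D by (simp add: zero_less_mult_iff)
    then have "ell0 D B ?e (norm (g x0)) \<eta>0 = \<infinity>" unfolding True using D by (intro ell0_infinite)
    then show ?thesis by (simp add: log_ereal_def)
  next
    case False
    then have e: "0 < ?e" using e0 by simp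
    define l where "l = max 1 (max (2 * D * norm (g x0) / ?e) (\<eta>0 * D\<^sup>2 / (sqrt 6 * B * ?e)))"
    note logs = startup_logs[OF \<eta>0 \<epsilon> start e, folded l_def]
    have "0 \<le> ln l" by (simp add: l_def)
    then have "real N \<le> 2000 * (1 + ln l + (?P + ?z + ?q))"
      using count logs z q P by argo
    moreover have "ell0 D B ?e (norm (g x0)) \<eta>0 = ereal l"
      unfolding l_def using e B by (intro ell0_finite) auto
    then have "log_ereal (ell0 D B ?e (norm (g x0)) \<eta>0) = ereal (ln l)" by (simp add: log_ereal_def)
    ultimately show ?thesis by (simp add: one_ereal_def)
  qed
  then show ?thesis using N by blast
qed

theorem theorem3p1:
  shows "\<exists>C::real. C > 0 \<and>
    (\<forall>(d::nat) (f :: fin_seq \<Rightarrow> real) (g :: fin_seq \<Rightarrow> fin_seq) (G :: fin_seq \<Rightarrow> fin_seq \<Rightarrow> fin_seq)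
      (H :: fin_seq \<Rightarrow> fin_seq \<Rightarrow> fin_seq) (xstar :: fin_seq) (x0 :: fin_seq)
      (\<delta>::real) (M0::real) (M1::real) (\<rho>::ereal) (D::real) (\<eta>0::real) (\<epsilon>::real).
      convex_on (Rn d) f \<longrightarrow>
      C2_on (Rn d) f g G \<longrightarrow>
      xstar \<in> Rn d \<longrightarrow> (\<forall>x\<in>Rn d. f xstar \<le> f x) \<longrightarrow>
      (\<forall>x\<in>Rn d. symmetric_on (Rn d) (H x)) \<longrightarrow>
      (\<forall>x\<in>Rn d. op_norm_on (Rn d) (\<lambda>u. H x u - G x u) \<le> \<delta>) \<longrightarrow>
      M0 \<ge> 0 \<longrightarrow> M1 \<ge> 0 \<longrightarrow>
      (global_hessian_smooth (Rn d) g G M0 M1 \<and> \<rho> = \<infinity> \<or>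
       (\<exists>r>0. local_hessian_smooth (Rn d) g G M0 M1 r \<and> \<rho> = ereal r)) \<longrightarrow>
      x0 \<in> Rn d \<longrightarrow>
      (\<exists>x\<in>Rn d. f x \<le> f x0 \<and> D = norm (x - x0)) \<longrightarrow>
      (\<forall>x\<in>Rn d. f x \<le> f x0 \<longrightarrow> norm (x - x0) \<le> D) \<longrightarrow>
      \<eta>0 > 0 \<longrightarrow> \<epsilon> > 0 \<longrightarrow>
      (let B = B_const D \<rho> M1;
           \<epsilon>tr = eps_tr D B M0 \<delta>;
           \<l>0 = ell0 D B \<epsilon>tr (norm (g x0)) \<eta>0
       in \<exists>N x \<eta>. arn_iterate (Rn d) g H x0 \<eta>0 N x \<eta> \<and> f x - f xstar \<le> \<epsilon> \<and>
            ereal (real N) \<le> ereal C *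
              (1 + log_ereal \<l>0 +
               ereal (B * log_plus ((f x0 - f xstar) / max \<epsilon> \<epsilon>tr)
                      + sqrt (M0 * D ^ 3 / \<epsilon>) + \<delta> * D ^ 2 / \<epsilon>))))"
proof (intro exI[of _ "2000 :: real"] conjI allI impI)
  fix d :: nat and f :: "fin_seq \<Rightarrow> real" and g :: "fin_seq \<Rightarrow> fin_seq"
    and G H :: "fin_seq \<Rightarrow> fin_seq \<Rightarrow> fin_seq" and xstar x0 :: fin_seq
    and \<delta> M0 M1 :: real and \<rho> :: ereal and D \<eta>0 \<epsilon> :: real
  assume convex: "convex_on (Rn d) f" and C2: "C2_on (Rn d) f g G"
    and xstar: "xstar \<in> Rn d" and minimizer: "\<forall>x\<in>Rn d. f xstar \<le> f x"
    and H_sym: "\<forall>x\<in>Rn d. symmetric_on (Rn d) (H x)"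
    and H_close: "\<forall>x\<in>Rn d. op_norm_on (Rn d) (\<lambda>u. H x u - G x u) \<le> \<delta>"
    and M0: "M0 \<ge> 0" and M1: "M1 \<ge> 0"
    and smooth: "global_hessian_smooth (Rn d) g G M0 M1 \<and> \<rho> = \<infinity> \<or>
       (\<exists>r>0. local_hessian_smooth (Rn d) g G M0 M1 r \<and> \<rho> = ereal r)"
    and x0: "x0 \<in> Rn d" and attained: "\<exists>x\<in>Rn d. f x \<le> f x0 \<and> D = norm (x - x0)"
    and level: "\<forall>x\<in>Rn d. f x \<le> f x0 \<longrightarrow> norm (x - x0) \<le> D"
    and \<eta>0: "\<eta>0 > 0" and \<epsilon>: "\<epsilon> > 0"
  define B where "B = B_const D \<rho> M1"
  define e where "e = eps_tr D B M0 \<delta>"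
  define l where "l = ell0 D B e (norm (g x0)) \<eta>0"
  have D0: "0 \<le> D" using attained by auto
  have B1: "1 \<le> B" and BM1: "6 * sqrt M1 * D \<le> B" by (simp_all add: B_def B_const_def)
  have problem: "newton_problem d f g G H xstar x0 \<delta> M0 M1 D B" if D: "0 < D"
  proof
    fix x y assume xy: "x \<in> Rn d" "y \<in> Rn d" and near: "norm (y - x) \<le> 2 * D / B"
    from smooth show "op_norm_on (Rn d) (\<lambda>u. G y u - G x u) \<le> (M0 + M1 * norm (g x)) * norm (y - x)"
    proof
      assume "\<exists>r>0. local_hessian_smooth (Rn d) g G M0 M1 r \<and> \<rho> = ereal r"
      then obtain r where r: "0 < r" "local_hessian_smooth (Rn d) g G M0 M1 r" "\<rho> = ereal r" by blast
      have "2 * D / r \<le> B" using r by (simp add: B_def B_const_def)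
      then have "2 * D / B \<le> r" using r(1) B1 by (simp add: field_simps)
      then show ?thesis using r(2) xy near by (simp add: local_hessian_smooth_def)
    qed (use xy in \<open>simp add: global_hessian_smooth_def\<close>)
  qed (use convex C2 xstar minimizer H_sym H_close M0 M1 x0 level D B1 BM1 in auto)
  have "\<exists>N x \<eta>. arn_iterate (Rn d) g H x0 \<eta>0 N x \<eta> \<and> f x - f xstar \<le> \<epsilon> \<and>
      ereal (real N) \<le> ereal 2000 * (1 + log_ereal l +
        ereal (B * log_plus ((f x0 - f xstar) / max \<epsilon> e) + sqrt (M0 * D ^ 3 / \<epsilon>) + \<delta> * D ^ 2 / \<epsilon>))"
  proof (cases "\<epsilon> < f x0 - f xstar")
    case True
    have "D \<noteq> 0"
    proof
      assume "D = 0"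
      then have "xstar = x0" using level xstar minimizer x0 by force
      then show False using True \<epsilon> by simp
    qed
    then have "0 < D" using D0 by simp
    from newton_problem.complexity[OF problem[OF this] \<eta>0 \<epsilon> True]
    show ?thesis unfolding l_def e_def .
  next
    case False
    have \<delta>D: "0 \<le> \<delta> * D\<^sup>2"
      using newton_problem.delta_nonneg[OF problem] D0 by (cases "D = 0") auto
    have "0 \<le> B * log_plus ((f x0 - f xstar) / max \<epsilon> e) + sqrt (M0 * D ^ 3 / \<epsilon>) + \<delta> * D ^ 2 / \<epsilon>"
    proof (intro add_nonneg_nonneg)
      show "0 \<le> \<delta> * D ^ 2 / \<epsilon>" using \<delta>D \<epsilon> by (rule divide_nonneg_pos)
    qed (use M0 D0 \<epsilon> B1 log_plus_nonneg in auto)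
    moreover have "0 \<le> log_ereal l" unfolding l_def by (intro log_ereal_nonneg one_le_ell0)
    ultimately have "ereal (real 0) \<le> ereal 2000 * (1 + log_ereal l +
        ereal (B * log_plus ((f x0 - f xstar) / max \<epsilon> e) + sqrt (M0 * D ^ 3 / \<epsilon>) + \<delta> * D ^ 2 / \<epsilon>))"
      by (simp add: zero_ereal_def[symmetric] ereal_0_le_mult)
    then show ?thesis using arn_iterate.start False by (metis not_less)
  qed
  then show "let B = B_const D \<rho> M1;
           \<epsilon>tr = eps_tr D B M0 \<delta>;
           \<l>0 = ell0 D B \<epsilon>tr (norm (g x0)) \<eta>0
       in \<exists>N x \<eta>. arn_iterate (Rn d) g H x0 \<eta>0 N x \<eta> \<and> f x - f xstar \<le> \<epsilon> \<and>
            ereal (real N) \<le> ereal 2000 *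
              (1 + log_ereal \<l>0 +
               ereal (B * log_plus ((f x0 - f xstar) / max \<epsilon> \<epsilon>tr)
                      + sqrt (M0 * D ^ 3 / \<epsilon>) + \<delta> * D ^ 2 / \<epsilon>))"
    unfolding Let_def l_def e_def B_def .
qed simp

end
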